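(* Let $\mathcal{B}$ be an ordinary category and let $\mathcal{Q}_{\mathcal{B}}$ be the free quantaloid on $\mathcal{B}$. Then the 2-category $\mathcal{Q}_{\mathcal{B}}\text{-}\mathbf{CAT}$ is 2-equivalent to the full sub-2-category of the strict slice 2-category $\mathbf{CAT}/\mathcal{B}$ on the faithful functors.
   Context: Size: fix a Grothendieck universe; sets in it are small. All ordinary categories have small hom-sets and a possibly large set of objects; $\mathbf{CAT}$ is the 2-category of such categories. The strict slice $\mathbf{CAT}/\mathcal{B}$ has as objects functors $p\colon\mathcal{E}\to\mathcal{B}$; 1-cells from $p$ to $q \colon \mathcal{F} \to \mathcal{B}$ are functors $F\colon \mathcal{E} \to \mathcal{F}$ with $qF=p$ strictly; 2-cells $F\Rightarrow G$ are natural transformations $\alpha$ with $q\alpha=1_p$. A quantaloid $\mathcal{Q}$ is a bicategory whose hom-categories $\mathcal{Q}(A,B)$ are complete (small) lattices and whose composition preserves joins in each variable. A $\mathcal{Q}$-category $\mathcal{C}$ consists of a possibly large set $\mathrm{ob}\,\mathcal{C}$, for each $x\in\mathrm{ob}\,\mathcal{C}$ an extent $|x|\in\mathcal{Q}$, and for all $x,y$ a hom-object $\mathcal{C}(x,y)\in\mathcal{Q}(|x|,|y|)$, with $1_{|x|}\leqslant\mathcal{C}(x,x)$ and $\mathcal{C}(y,z)\circ\mathcal{C}(x,y)\leqslant\mathcal{C}(x,z)$. A $\mathcal{Q}$-functor $F\colon\mathcal{C}\to\mathcal{D}$ is an extent-preserving function on objects with $\mathcal{C}(x,y)\leqslant\mathcal{D}(Fx,Fy)$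 for all $x,y$. Between $\mathcal{Q}$-functors $F,G\colon\mathcal{C}\to\mathcal{D}$ there is at most one $\mathcal{Q}$-transformation, existing just when $1_{|x|}\leqslant\mathcal{D}(Fx,Gx)$ for all $x$. These form the 2-category $\mathcal{Q}\text{-}\mathbf{CAT}$. The free quantaloid $\mathcal{Q}_{\mathcal{B}}$ has the objects of $\mathcal{B}$; morphisms from $X$ to $Y$ are subsets $U\subseteq\mathcal{B}(X,Y)$ ordered by inclusion; $V\circ U=\{v\circ u\mid v\in V,u\in U\}$; the identity at $X$ is $\{1_X\}$. *)

theory Defs
  imports "HOL-Algebra.Complete_Lattice" "HOL-Library.FuncSet"
begin

section \<open>Size\<close>

text \<open>The universe is a type \<open>'v\<close>; \<open>el v\<close> is the set of elements of \<open>v\<close>, and the small sets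
  are the sets of the form \<open>el v\<close>. Large sets are arbitrary sets in arbitrary types.\<close>

locale grothendieck_universe =
  fixes el :: "'v \<Rightarrow> 'v set"
  assumes extensionality: "inj el"
    and foundation: "wf {(x, y). x \<in> el y}"
    and subset: "A \<subseteq> el x \<Longrightarrow> A \<in> range el"
    and pairing: "{x, y} \<in> range el"
    and powerset: "{y. el y \<subseteq> el x} \<in> range el"
    and union: "(\<Union>i\<in>el x. el (f i)) \<in> range el"

definition small :: "('v \<Rightarrow> 'v set) \<Rightarrow> 'v set \<Rightarrow> bool" where
  "small el A \<longleftrightarrow> A \<in> range el"

text \<open>The element of the universe with a given (small) set of elements.\<close>

definition code :: "('v \<Rightarrow> 'v set) \<Rightarrow> 'v set \<Rightarrow> 'v" where
  "code el = inv el"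

section \<open>Categories, functors and natural transformations\<close>

text \<open>Categories are given by families of hom-sets, which need not be disjoint; so every
  operation on morphisms takes the objects involved as arguments.
  \<open>Comp C x y z g f\<close> is the composite of \<open>f : x \<rightarrow> y\<close> and \<open>g : y \<rightarrow> z\<close>.\<close>

record ('o, 'm) cat =
  Obj :: "'o set"
  Hom :: "'o \<Rightarrow> 'o \<Rightarrow> 'm set"
  Id :: "'o \<Rightarrow> 'm"
  Comp :: "'o \<Rightarrow> 'o \<Rightarrow> 'o \<Rightarrow> 'm \<Rightarrow> 'm \<Rightarrow> 'm"

locale category =
  fixes C :: "('o, 'm) cat"
  assumes id_in_hom: "x \<in> Obj C \<Longrightarrow> Id C x \<in> Hom C x x"
    and comp_in_hom: "\<lbrakk>x \<in> Obj C; y \<in> Obj C; z \<in> Obj C; f \<in> Hom C x y; g \<in> Hom C y z\<rbrakk>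
      \<Longrightarrow> Comp C x y z g f \<in> Hom C x z"
    and id_left: "\<lbrakk>x \<in> Obj C; y \<in> Obj C; f \<in> Hom C x y\<rbrakk> \<Longrightarrow> Comp C x y y (Id C y) f = f"
    and id_right: "\<lbrakk>x \<in> Obj C; y \<in> Obj C; f \<in> Hom C x y\<rbrakk> \<Longrightarrow> Comp C x x y f (Id C x) = f"
    and assoc: "\<lbrakk>w \<in> Obj C; x \<in> Obj C; y \<in> Obj C; z \<in> Obj C;
        f \<in> Hom C w x; g \<in> Hom C x y; h \<in> Hom C y z\<rbrakk>
      \<Longrightarrow> Comp C w x z (Comp C x y z h g) f = Comp C w y z h (Comp C w x y g f)"

locale ordinary_category = category C
  for el :: "'v \<Rightarrow> 'v set" and C :: "('o, 'v) cat" +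
  assumes small_homs: "\<lbrakk>x \<in> Obj C; y \<in> Obj C\<rbrakk> \<Longrightarrow> small el (Hom C x y)"

definition prod_cat :: "('o, 'm) cat \<Rightarrow> ('p, 'n) cat \<Rightarrow> ('o \<times> 'p, 'm \<times> 'n) cat" where
  "prod_cat C D =
    \<lparr>Obj = Obj C \<times> Obj D,
     Hom = (\<lambda>(x, y) (x', y'). Hom C x x' \<times> Hom D y y'),
     Id = (\<lambda>(x, y). (Id C x, Id D y)),
     Comp = (\<lambda>(x, y) (x', y') (x'', y'') (g, k) (f, h). (Comp C x x' x'' g f, Comp D y y' y'' k h))\<rparr>"

record ('o, 'm, 'p, 'n) ftor =
  fobj :: "'o \<Rightarrow> 'p"
  fmor :: "'o \<Rightarrow> 'o \<Rightarrow> 'm \<Rightarrow> 'n"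

locale is_functor =
  fixes C :: "('o, 'm) cat" and D :: "('p, 'n) cat" and F :: "('o, 'm, 'p, 'n) ftor"
  assumes obj: "x \<in> Obj C \<Longrightarrow> fobj F x \<in> Obj D"
    and mor: "\<lbrakk>x \<in> Obj C; y \<in> Obj C; f \<in> Hom C x y\<rbrakk>
      \<Longrightarrow> fmor F x y f \<in> Hom D (fobj F x) (fobj F y)"
    and pres_id: "x \<in> Obj C \<Longrightarrow> fmor F x x (Id C x) = Id D (fobj F x)"
    and pres_comp: "\<lbrakk>x \<in> Obj C; y \<in> Obj C; z \<in> Obj C; f \<in> Hom C x y; g \<in> Hom C y z\<rbrakk>
      \<Longrightarrow> fmor F x z (Comp C x y z g f)
        = Comp D (fobj F x) (fobj F y) (fobj F z) (fmor F y z g) (fmor F x y f)"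

definition faithful :: "('o, 'm) cat \<Rightarrow> ('o, 'm, 'p, 'n) ftor \<Rightarrow> bool" where
  "faithful C F \<longleftrightarrow> (\<forall>x\<in>Obj C. \<forall>y\<in>Obj C. inj_on (fmor F x y) (Hom C x y))"

definition id_ftor :: "('o, 'm, 'o, 'm) ftor" where
  "id_ftor = \<lparr>fobj = (\<lambda>x. x), fmor = (\<lambda>x y f. f)\<rparr>"

definition comp_ftor ::
  "('p, 'n, 'q, 'k) ftor \<Rightarrow> ('o, 'm, 'p, 'n) ftor \<Rightarrow> ('o, 'm, 'q, 'k) ftor" where
  "comp_ftor G F =
    \<lparr>fobj = (\<lambda>x. fobj G (fobj F x)),
     fmor = (\<lambda>x y f. fmor G (fobj F x) (fobj F y) (fmor F x y f))\<rparr>"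

text \<open>Functors, \<open>\<Q>\<close>-functors and natural transformations that serve as cells of a 2-category
  take the value \<open>undefined\<close> outside their domain, so that equality of cells is
  the equality of mathematics. Objects (categories and \<open>\<Q>\<close>-categories) are not normalised in
  this way: two records that differ only outside their set of objects or their hom-sets are
  isomorphic in the 2-category.\<close>

definition restrict_ftor :: "('o, 'm) cat \<Rightarrow> ('o, 'm, 'p, 'n) ftor \<Rightarrow> ('o, 'm, 'p, 'n) ftor" where
  "restrict_ftor C F =
    \<lparr>fobj = restrict (fobj F) (Obj C),
     fmor = (\<lambda>x y f. if x \<in> Obj C \<and> y \<in> Obj C \<and> f \<in> Hom C x y then fmor F x y f else undefined)\<rparr>"

definition functors :: "('o, 'm) cat \<Rightarrow> ('p, 'n) cat \<Rightarrow> ('o, 'm, 'p, 'n) ftor set" where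
  "functors C D = {F. is_functor C D F \<and> restrict_ftor C F = F}"

definition nat_transfs :: "('o, 'm) cat \<Rightarrow> ('p, 'n) cat
    \<Rightarrow> ('o, 'm, 'p, 'n) ftor \<Rightarrow> ('o, 'm, 'p, 'n) ftor \<Rightarrow> ('o \<Rightarrow> 'n) set" where
  "nat_transfs C D F G = {\<alpha> \<in> extensional (Obj C).
    (\<forall>x\<in>Obj C. \<alpha> x \<in> Hom D (fobj F x) (fobj G x)) \<and>
    (\<forall>x\<in>Obj C. \<forall>y\<in>Obj C. \<forall>f\<in>Hom C x y.
      Comp D (fobj F x) (fobj F y) (fobj G y) (\<alpha> y) (fmor F x y f)
        = Comp D (fobj F x) (fobj G x) (fobj G y) (fmor G x y f) (\<alpha> x))}"

definition functor_cat ::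
  "('o, 'm) cat \<Rightarrow> ('p, 'n) cat \<Rightarrow> (('o, 'm, 'p, 'n) ftor, 'o \<Rightarrow> 'n) cat" where
  "functor_cat C D =
    \<lparr>Obj = functors C D,
     Hom = nat_transfs C D,
     Id = (\<lambda>F. \<lambda>x\<in>Obj C. Id D (fobj F x)),
     Comp = (\<lambda>F G H \<beta> \<alpha>. \<lambda>x\<in>Obj C. Comp D (fobj F x) (fobj G x) (fobj H x) (\<beta> x) (\<alpha> x))\<rparr>"

section \<open>Strict 2-categories\<close>

text \<open>A 2-category is presented as a category enriched in categories: \<open>Hom2 K a b\<close> is the
  hom-category, whose objects are the 1-cells \<open>a \<rightarrow> b\<close> and whose morphisms are the 2-cells
  between them. The composition functor \<open>Comp2 K a b c\<close> sends a pair of 1-cells \<open>(g, f)\<close> to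
  their composite and a pair of 2-cells \<open>(\<beta>, \<alpha>)\<close> to their horizontal composite.\<close>

record ('o, 'a, 't) cat2 =
  Obj2 :: "'o set"
  Hom2 :: "'o \<Rightarrow> 'o \<Rightarrow> ('a, 't) cat"
  Id2 :: "'o \<Rightarrow> 'a"
  Comp2 :: "'o \<Rightarrow> 'o \<Rightarrow> 'o \<Rightarrow> ('a \<times> 'a, 't \<times> 't, 'a, 't) ftor"

abbreviation comp1 :: "('o, 'a, 't) cat2 \<Rightarrow> 'o \<Rightarrow> 'o \<Rightarrow> 'o \<Rightarrow> 'a \<Rightarrow> 'a \<Rightarrow> 'a" where
  "comp1 K a b c g f \<equiv> fobj (Comp2 K a b c) (g, f)"

text \<open>For 2-cells \<open>\<alpha> : f \<rightarrow> f'\<close> between 1-cells \<open>a \<rightarrow> b\<close> and \<open>\<beta> : g \<rightarrow> g'\<close> between 1-cells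
  \<open>b \<rightarrow> c\<close>, the horizontal composite \<open>hcomp K a b c g g' f f' \<beta> \<alpha>\<close> goes from \<open>gf\<close> to \<open>g'f'\<close>.\<close>

abbreviation hcomp :: "('o, 'a, 't) cat2 \<Rightarrow> 'o \<Rightarrow> 'o \<Rightarrow> 'o \<Rightarrow> 'a \<Rightarrow> 'a \<Rightarrow> 'a \<Rightarrow> 'a \<Rightarrow> 't \<Rightarrow> 't \<Rightarrow> 't" where
  "hcomp K a b c g g' f f' \<beta> \<alpha> \<equiv> fmor (Comp2 K a b c) (g, f) (g', f') (\<beta>, \<alpha>)"

locale two_category =
  fixes K :: "('o, 'a, 't) cat2"
  assumes hom_category: "\<lbrakk>a \<in> Obj2 K; b \<in> Obj2 K\<rbrakk> \<Longrightarrow> category (Hom2 K a b)"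
    and id1: "a \<in> Obj2 K \<Longrightarrow> Id2 K a \<in> Obj (Hom2 K a a)"
    and comp_functor: "\<lbrakk>a \<in> Obj2 K; b \<in> Obj2 K; c \<in> Obj2 K\<rbrakk>
      \<Longrightarrow> is_functor (prod_cat (Hom2 K b c) (Hom2 K a b)) (Hom2 K a c) (Comp2 K a b c)"
    and left_unit1: "\<lbrakk>a \<in> Obj2 K; b \<in> Obj2 K; f \<in> Obj (Hom2 K a b)\<rbrakk>
      \<Longrightarrow> comp1 K a b b (Id2 K b) f = f"
    and right_unit1: "\<lbrakk>a \<in> Obj2 K; b \<in> Obj2 K; f \<in> Obj (Hom2 K a b)\<rbrakk>
      \<Longrightarrow> comp1 K a a b f (Id2 K a) = f"
    and left_unit2: "\<lbrakk>a \<in> Obj2 K; b \<in> Obj2 K; f \<in> Obj (Hom2 K a b); f' \<in> Obj (Hom2 K a b);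
        \<alpha> \<in> Hom (Hom2 K a b) f f'\<rbrakk>
      \<Longrightarrow> hcomp K a b b (Id2 K b) (Id2 K b) f f' (Id (Hom2 K b b) (Id2 K b)) \<alpha> = \<alpha>"
    and right_unit2: "\<lbrakk>a \<in> Obj2 K; b \<in> Obj2 K; f \<in> Obj (Hom2 K a b); f' \<in> Obj (Hom2 K a b);
        \<alpha> \<in> Hom (Hom2 K a b) f f'\<rbrakk>
      \<Longrightarrow> hcomp K a a b f f' (Id2 K a) (Id2 K a) \<alpha> (Id (Hom2 K a a) (Id2 K a)) = \<alpha>"
    and assoc1: "\<lbrakk>a \<in> Obj2 K; b \<in> Obj2 K; c \<in> Obj2 K; d \<in> Obj2 K;
        f \<in> Obj (Hom2 K a b); g \<in> Obj (Hom2 K b c); h \<in> Obj (Hom2 K c d)\<rbrakk>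
      \<Longrightarrow> comp1 K a b d (comp1 K b c d h g) f = comp1 K a c d h (comp1 K a b c g f)"
    and assoc2: "\<lbrakk>a \<in> Obj2 K; b \<in> Obj2 K; c \<in> Obj2 K; d \<in> Obj2 K;
        f \<in> Obj (Hom2 K a b); f' \<in> Obj (Hom2 K a b); \<alpha> \<in> Hom (Hom2 K a b) f f';
        g \<in> Obj (Hom2 K b c); g' \<in> Obj (Hom2 K b c); \<beta> \<in> Hom (Hom2 K b c) g g';
        h \<in> Obj (Hom2 K c d); h' \<in> Obj (Hom2 K c d); \<gamma> \<in> Hom (Hom2 K c d) h h'\<rbrakk>
      \<Longrightarrow> hcomp K a b d (comp1 K b c d h g) (comp1 K b c d h' g') f f'
            (hcomp K b c d h h' g g' \<gamma> \<beta>) \<alpha>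
        = hcomp K a c d h h' (comp1 K a b c g f) (comp1 K a b c g' f')
            \<gamma> (hcomp K a b c g g' f f' \<beta> \<alpha>)"

record ('o, 'a, 't, 'p, 'b, 's) ftor2 =
  obj2 :: "'o \<Rightarrow> 'p"
  hom2 :: "'o \<Rightarrow> 'o \<Rightarrow> ('a, 't, 'b, 's) ftor"

locale two_functor =
  fixes K :: "('o, 'a, 't) cat2" and L :: "('p, 'b, 's) cat2"
    and F :: "('o, 'a, 't, 'p, 'b, 's) ftor2"
  assumes obj: "a \<in> Obj2 K \<Longrightarrow> obj2 F a \<in> Obj2 L"
    and hom_functor: "\<lbrakk>a \<in> Obj2 K; b \<in> Obj2 K\<rbrakk>
      \<Longrightarrow> is_functor (Hom2 K a b) (Hom2 L (obj2 F a) (obj2 F b)) (hom2 F a b)"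
    and pres_id1: "a \<in> Obj2 K \<Longrightarrow> fobj (hom2 F a a) (Id2 K a) = Id2 L (obj2 F a)"
    and pres_comp1: "\<lbrakk>a \<in> Obj2 K; b \<in> Obj2 K; c \<in> Obj2 K;
        f \<in> Obj (Hom2 K a b); g \<in> Obj (Hom2 K b c)\<rbrakk>
      \<Longrightarrow> fobj (hom2 F a c) (comp1 K a b c g f)
        = comp1 L (obj2 F a) (obj2 F b) (obj2 F c) (fobj (hom2 F b c) g) (fobj (hom2 F a b) f)"
    and pres_comp2: "\<lbrakk>a \<in> Obj2 K; b \<in> Obj2 K; c \<in> Obj2 K;
        f \<in> Obj (Hom2 K a b); f' \<in> Obj (Hom2 K a b); \<alpha> \<in> Hom (Hom2 K a b) f f';
        g \<in> Obj (Hom2 K b c); g' \<in> Obj (Hom2 K b c); \<beta> \<in> Hom (Hom2 K b c) g g'\<rbrakk>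
      \<Longrightarrow> fmor (hom2 F a c) (comp1 K a b c g f) (comp1 K a b c g' f') (hcomp K a b c g g' f f' \<beta> \<alpha>)
        = hcomp L (obj2 F a) (obj2 F b) (obj2 F c)
            (fobj (hom2 F b c) g) (fobj (hom2 F b c) g') (fobj (hom2 F a b) f) (fobj (hom2 F a b) f')
            (fmor (hom2 F b c) g g' \<beta>) (fmor (hom2 F a b) f f' \<alpha>)"

definition id_ftor2 :: "('o, 'a, 't, 'o, 'a, 't) ftor2" where
  "id_ftor2 = \<lparr>obj2 = (\<lambda>a. a), hom2 = (\<lambda>a b. id_ftor)\<rparr>"

definition comp_ftor2 :: "('p, 'b, 's, 'q, 'c, 'r) ftor2 \<Rightarrow> ('o, 'a, 't, 'p, 'b, 's) ftor2
    \<Rightarrow> ('o, 'a, 't, 'q, 'c, 'r) ftor2" where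
  "comp_ftor2 G F =
    \<lparr>obj2 = (\<lambda>a. obj2 G (obj2 F a)),
     hom2 = (\<lambda>a b. comp_ftor (hom2 G (obj2 F a) (obj2 F b)) (hom2 F a b))\<rparr>"

definition iso1 :: "('o, 'a, 't) cat2 \<Rightarrow> 'o \<Rightarrow> 'o \<Rightarrow> 'a \<Rightarrow> bool" where
  "iso1 K a b f \<longleftrightarrow> f \<in> Obj (Hom2 K a b) \<and>
    (\<exists>g\<in>Obj (Hom2 K b a). comp1 K a b a g f = Id2 K a \<and> comp1 K b a b f g = Id2 K b)"

locale two_natural_transformation =
  fixes K :: "('o, 'a, 't) cat2" and L :: "('p, 'b, 's) cat2"
    and F G :: "('o, 'a, 't, 'p, 'b, 's) ftor2" and \<eta> :: "'o \<Rightarrow> 'b"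
  assumes component: "a \<in> Obj2 K \<Longrightarrow> \<eta> a \<in> Obj (Hom2 L (obj2 F a) (obj2 G a))"
    and natural1: "\<lbrakk>a \<in> Obj2 K; b \<in> Obj2 K; f \<in> Obj (Hom2 K a b)\<rbrakk>
      \<Longrightarrow> comp1 L (obj2 F a) (obj2 F b) (obj2 G b) (\<eta> b) (fobj (hom2 F a b) f)
        = comp1 L (obj2 F a) (obj2 G a) (obj2 G b) (fobj (hom2 G a b) f) (\<eta> a)"
    and natural2: "\<lbrakk>a \<in> Obj2 K; b \<in> Obj2 K; f \<in> Obj (Hom2 K a b); f' \<in> Obj (Hom2 K a b);
        \<alpha> \<in> Hom (Hom2 K a b) f f'\<rbrakk>
      \<Longrightarrow> hcomp L (obj2 F a) (obj2 F b) (obj2 G b)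
            (\<eta> b) (\<eta> b) (fobj (hom2 F a b) f) (fobj (hom2 F a b) f')
            (Id (Hom2 L (obj2 F b) (obj2 G b)) (\<eta> b)) (fmor (hom2 F a b) f f' \<alpha>)
        = hcomp L (obj2 F a) (obj2 G a) (obj2 G b)
            (fobj (hom2 G a b) f) (fobj (hom2 G a b) f') (\<eta> a) (\<eta> a)
            (fmor (hom2 G a b) f f' \<alpha>) (Id (Hom2 L (obj2 F a) (obj2 G a)) (\<eta> a))"

locale two_natural_isomorphism = two_natural_transformation +
  assumes invertible: "a \<in> Obj2 K \<Longrightarrow> iso1 L (obj2 F a) (obj2 G a) (\<eta> a)"

definition two_equivalent :: "('o, 'a, 't) cat2 \<Rightarrow> ('p, 'b, 's) cat2 \<Rightarrow> bool" where
  "two_equivalent K L \<longleftrightarrow> two_category K \<and> two_category L \<and>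
    (\<exists>F G \<eta> \<epsilon>. two_functor K L F \<and> two_functor L K G \<and>
      two_natural_isomorphism K K id_ftor2 (comp_ftor2 G F) \<eta> \<and>
      two_natural_isomorphism L L (comp_ftor2 F G) id_ftor2 \<epsilon>)"

text \<open>The strict slice \<open>K/b\<close>. The condition on a 2-cell \<open>\<alpha>\<close> says that whiskering it with \<open>q\<close>
  gives the identity 2-cell of \<open>p\<close>.\<close>

definition slice2 :: "('o, 'a, 't) cat2 \<Rightarrow> 'o \<Rightarrow> ('o \<times> 'a, 'a, 't) cat2" where
  "slice2 K b =
    \<lparr>Obj2 = {(e, p). e \<in> Obj2 K \<and> p \<in> Obj (Hom2 K e b)},
     Hom2 = (\<lambda>(e, p) (f, q).
       \<lparr>Obj = {h \<in> Obj (Hom2 K e f). comp1 K e f b q h = p},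
        Hom = (\<lambda>h k. {\<alpha> \<in> Hom (Hom2 K e f) h k.
          hcomp K e f b q q h k (Id (Hom2 K f b) q) \<alpha> = Id (Hom2 K e b) p}),
        Id = Id (Hom2 K e f),
        Comp = Comp (Hom2 K e f)\<rparr>),
     Id2 = (\<lambda>(e, p). Id2 K e),
     Comp2 = (\<lambda>(e, p) (f, q) (g, r). Comp2 K e f g)\<rparr>"

definition full_sub2 :: "('o, 'a, 't) cat2 \<Rightarrow> ('o \<Rightarrow> bool) \<Rightarrow> ('o, 'a, 't) cat2" where
  "full_sub2 K P = K\<lparr>Obj2 := {a \<in> Obj2 K. P a}\<rparr>"

text \<open>In the horizontal composite of \<open>\<beta> : G \<rightarrow> G'\<close> and \<open>\<alpha> : F \<rightarrow> F'\<close> the component at \<open>x\<close> is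
  \<open>\<beta>\<^bsub>F'x\<^esub> \<circ> G(\<alpha>\<^bsub>x\<^esub>)\<close>.\<close>

definition CAT :: "('v \<Rightarrow> 'v set) \<Rightarrow> (('o, 'v) cat, ('o, 'v, 'o, 'v) ftor, 'o \<Rightarrow> 'v) cat2" where
  "CAT el =
    \<lparr>Obj2 = {C. ordinary_category el C},
     Hom2 = functor_cat,
     Id2 = (\<lambda>C. restrict_ftor C id_ftor),
     Comp2 = (\<lambda>C D E.
       \<lparr>fobj = (\<lambda>(G, F). restrict_ftor C (comp_ftor G F)),
        fmor = (\<lambda>(G, F) (G', F') (\<beta>, \<alpha>). \<lambda>x\<in>Obj C.
          Comp E (fobj G (fobj F x)) (fobj G (fobj F' x)) (fobj G' (fobj F' x))
            (\<beta> (fobj F' x)) (fmor G (fobj F x) (fobj F' x) (\<alpha> x)))\<rparr>)\<rparr>"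

section \<open>Quantaloids and categories enriched in them\<close>

text \<open>Since the hom-lattices are antisymmetric, isomorphic 1-cells are equal, so the
  associativity and unit constraints of the bicategory are equalities. Their coherence and
  the functoriality of composition (its monotonicity) are automatic.\<close>

record ('o, 'v) qtd =
  QObj :: "'o set"
  QHom :: "'o \<Rightarrow> 'o \<Rightarrow> 'v gorder"
  QId :: "'o \<Rightarrow> 'v"
  QComp :: "'o \<Rightarrow> 'o \<Rightarrow> 'o \<Rightarrow> 'v \<Rightarrow> 'v \<Rightarrow> 'v"

definition underlying_cat :: "('o, 'v) qtd \<Rightarrow> ('o, 'v) cat" where
  "underlying_cat Q =
    \<lparr>Obj = QObj Q, Hom = (\<lambda>A B. carrier (QHom Q A B)), Id = QId Q, Comp = QComp Q\<rparr>"

locale quantaloid =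
  fixes el :: "'v \<Rightarrow> 'v set" and Q :: "('o, 'v) qtd"
  assumes cat: "ordinary_category el (underlying_cat Q)"
    and hom_lattice: "\<lbrakk>A \<in> QObj Q; B \<in> QObj Q\<rbrakk> \<Longrightarrow> complete_lattice (QHom Q A B)"
    and comp_sup_left: "\<lbrakk>A \<in> QObj Q; B \<in> QObj Q; C \<in> QObj Q; u \<in> carrier (QHom Q A B)\<rbrakk>
      \<Longrightarrow> sup_pres (QHom Q B C) (QHom Q A C) (\<lambda>v. QComp Q A B C v u)"
    and comp_sup_right: "\<lbrakk>A \<in> QObj Q; B \<in> QObj Q; C \<in> QObj Q; v \<in> carrier (QHom Q B C)\<rbrakk>
      \<Longrightarrow> sup_pres (QHom Q A B) (QHom Q A C) (\<lambda>u. QComp Q A B C v u)"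

record ('x, 'o, 'v) qcat =
  qobj :: "'x set"
  extent :: "'x \<Rightarrow> 'o"
  qhom :: "'x \<Rightarrow> 'x \<Rightarrow> 'v"

locale q_category =
  fixes Q :: "('o, 'v) qtd" and C :: "('x, 'o, 'v) qcat"
  assumes extent: "x \<in> qobj C \<Longrightarrow> extent C x \<in> QObj Q"
    and hom: "\<lbrakk>x \<in> qobj C; y \<in> qobj C\<rbrakk>
      \<Longrightarrow> qhom C x y \<in> carrier (QHom Q (extent C x) (extent C y))"
    and unit: "x \<in> qobj C
      \<Longrightarrow> QId Q (extent C x) \<sqsubseteq>\<^bsub>QHom Q (extent C x) (extent C x)\<^esub> qhom C x x"
    and comp: "\<lbrakk>x \<in> qobj C; y \<in> qobj C; z \<in> qobj C\<rbrakk>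
      \<Longrightarrow> QComp Q (extent C x) (extent C y) (extent C z) (qhom C y z) (qhom C x y)
        \<sqsubseteq>\<^bsub>QHom Q (extent C x) (extent C z)\<^esub> qhom C x z"

definition q_functors :: "('o, 'v) qtd \<Rightarrow> ('x, 'o, 'v) qcat \<Rightarrow> ('y, 'o, 'v) qcat \<Rightarrow> ('x \<Rightarrow> 'y) set" where
  "q_functors Q C D = {F \<in> qobj C \<rightarrow>\<^sub>E qobj D.
    (\<forall>x\<in>qobj C. extent D (F x) = extent C x) \<and>
    (\<forall>x\<in>qobj C. \<forall>y\<in>qobj C.
      qhom C x y \<sqsubseteq>\<^bsub>QHom Q (extent C x) (extent C y)\<^esub> qhom D (F x) (F y))}"

text \<open>The unique 2-cell between two \<open>\<Q>\<close>-functors, if there is one, is \<open>()\<close>.\<close>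

definition q_transfs ::
  "('o, 'v) qtd \<Rightarrow> ('x, 'o, 'v) qcat \<Rightarrow> ('y, 'o, 'v) qcat \<Rightarrow> ('x \<Rightarrow> 'y) \<Rightarrow> ('x \<Rightarrow> 'y) \<Rightarrow> unit set" where
  "q_transfs Q C D F G = {u. \<forall>x\<in>qobj C.
    QId Q (extent C x) \<sqsubseteq>\<^bsub>QHom Q (extent C x) (extent C x)\<^esub> qhom D (F x) (G x)}"

definition QCAT :: "('o, 'v) qtd \<Rightarrow> (('x, 'o, 'v) qcat, 'x \<Rightarrow> 'x, unit) cat2" where
  "QCAT Q =
    \<lparr>Obj2 = {C. q_category Q C},
     Hom2 = (\<lambda>C D.
       \<lparr>Obj = q_functors Q C D,
        Hom = q_transfs Q C D,
        Id = (\<lambda>F. ()),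
        Comp = (\<lambda>F G H \<beta> \<alpha>. ())\<rparr>),
     Id2 = (\<lambda>C. \<lambda>x\<in>qobj C. x),
     Comp2 = (\<lambda>C D E.
       \<lparr>fobj = (\<lambda>(G, F). compose (qobj C) G F),
        fmor = (\<lambda>GF GF' \<beta>\<alpha>. ())\<rparr>)\<rparr>"

text \<open>A morphism of the free quantaloid on \<open>B\<close> is a subset of a hom-set of \<open>B\<close>, regarded as an
  element of the universe.\<close>

definition free_quantaloid :: "('v \<Rightarrow> 'v set) \<Rightarrow> ('o, 'v) cat \<Rightarrow> ('o, 'v) qtd" where
  "free_quantaloid el B =
    \<lparr>QObj = Obj B,
     QHom = (\<lambda>X Y. \<lparr>carrier = {U. el U \<subseteq> Hom B X Y}, eq = (=), le = (\<lambda>U V. el U \<subseteq> el V)\<rparr>),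
     QId = (\<lambda>X. code el {Id B X}),
     QComp = (\<lambda>X Y Z V U. code el {Comp B X Y Z v u | v u. v \<in> el V \<and> u \<in> el U})\<rparr>"

lemma quantaloid_free_quantaloid:
  assumes "grothendieck_universe el" and "ordinary_category el B"
  shows "quantaloid el (free_quantaloid el B)"
proof -
  interpret U: grothendieck_universe el by fact
  interpret B: ordinary_category el B by fact
  let ?Q = "free_quantaloid el B"
  have el_eq: "x = y" if "el x = el y" for x y
    using U.extensionality that by (rule injD)
  have el_code: "el (code el A) = A" if t: "A \<subseteq> Hom B X Y" "X \<in> Obj B" "Y \<in> Obj B" for A X Y
  proof -
    obtain v where "Hom B X Y = el v" using B.small_homs[OF t(2,3)] by (auto simp: small_def)
    then have "A \<in> range el" using U.subset[of A v] t(1) by simp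
    then show ?thesis unfolding code_def by (simp add: f_inv_into_f)
  qed
  have Q: "carrier (QHom ?Q X Y) = {U. el U \<subseteq> Hom B X Y}" "QObj ?Q = Obj B"
      "u \<sqsubseteq>\<^bsub>QHom ?Q X Y\<^esub> v \<longleftrightarrow> el u \<subseteq> el v" for X Y u v
    by (simp_all add: free_quantaloid_def)
  have comp_sub: "{Comp B X Y Z v u | v u. v \<in> V \<and> u \<in> W} \<subseteq> Hom B X Z"
    if "X \<in> Obj B" "Y \<in> Obj B" "Z \<in> Obj B" "V \<subseteq> Hom B Y Z" "W \<subseteq> Hom B X Y" for X Y Z V W
    using that by (auto intro!: B.comp_in_hom)
  have el_comp: "el (QComp ?Q X Y Z v u) = {Comp B X Y Z v' u' | v' u'. v' \<in> el v \<and> u' \<in> el u}"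
    if "X \<in> Obj B" "Y \<in> Obj B" "Z \<in> Obj B" "el v \<subseteq> Hom B Y Z" "el u \<subseteq> Hom B X Y" for X Y Z v u
    using el_code[OF comp_sub[OF that]] that by (simp add: free_quantaloid_def)
  have comp_hom: "el (QComp ?Q X Y Z v u) \<subseteq> Hom B X Z"
    if "X \<in> Obj B" "Y \<in> Obj B" "Z \<in> Obj B" "el v \<subseteq> Hom B Y Z" "el u \<subseteq> Hom B X Y" for X Y Z v u
    unfolding el_comp[OF that] by (rule comp_sub[OF that])
  have el_id: "el (QId ?Q X) = {Id B X}" if "X \<in> Obj B" for X
    using el_code[of "{Id B X}" X X] that B.id_in_hom by (simp add: free_quantaloid_def)
  have po: "partial_order (QHom ?Q X Y)" for X Y
    by unfold_locales (auto simp: free_quantaloid_def intro: el_eq)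
  have lub: "least (QHom ?Q X Y) (code el (\<Union>(el ` A))) (Upper (QHom ?Q X Y) A)"
    and el_lub: "el (code el (\<Union>(el ` A))) = \<Union>(el ` A)"
    if XY: "X \<in> Obj B" "Y \<in> Obj B" and A: "A \<subseteq> carrier (QHom ?Q X Y)" for X Y A
  proof -
    have s: "\<Union>(el ` A) \<subseteq> Hom B X Y" using A by (auto simp: Q)
    show e: "el (code el (\<Union>(el ` A))) = \<Union>(el ` A)" by (rule el_code[OF s XY])
    show "least (QHom ?Q X Y) (code el (\<Union>(el ` A))) (Upper (QHom ?Q X Y) A)"
      using s A unfolding least_def Upper_def Q by (simp add: e) blast
  qed
  have glb: "\<exists>i. greatest (QHom ?Q X Y) i (Lower (QHom ?Q X Y) A)"
    if XY: "X \<in> Obj B" "Y \<in> Obj B" and A: "A \<subseteq> carrier (QHom ?Q X Y)" for X Y A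
  proof -
    have s: "Hom B X Y \<inter> \<Inter>(el ` A) \<subseteq> Hom B X Y" by auto
    have e: "el (code el (Hom B X Y \<inter> \<Inter>(el ` A))) = Hom B X Y \<inter> \<Inter>(el ` A)"
      by (rule el_code[OF s XY])
    have "greatest (QHom ?Q X Y) (code el (Hom B X Y \<inter> \<Inter>(el ` A))) (Lower (QHom ?Q X Y) A)"
      using A unfolding greatest_def Lower_def Q by (simp add: e) blast
    then show ?thesis ..
  qed
  have lattice: "complete_lattice (QHom ?Q X Y)" if "X \<in> Obj B" "Y \<in> Obj B" for X Y
    by (rule partial_order.complete_latticeI[OF po]) (use lub[OF that] glb[OF that] in blast)+
  have el_sup: "el (\<Squnion>\<^bsub>QHom ?Q X Y\<^esub> A) = \<Union>(el ` A)"
    if XY: "X \<in> Obj B" "Y \<in> Obj B" and A: "A \<subseteq> carrier (QHom ?Q X Y)" for X Y A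
  proof -
    have "least (QHom ?Q X Y) (\<Squnion>\<^bsub>QHom ?Q X Y\<^esub> A) (Upper (QHom ?Q X Y) A)"
      unfolding sup_def using lub[OF that] by (rule someI)
    then have "\<Squnion>\<^bsub>QHom ?Q X Y\<^esub> A = code el (\<Union>(el ` A))"
      using lub[OF that] by (rule partial_order.least_unique[OF po])
    then show ?thesis using el_lub[OF that] by simp
  qed
  show ?thesis
  proof (rule quantaloid.intro)
    have ud: "Obj (underlying_cat ?Q) = Obj B" "Hom (underlying_cat ?Q) X Y = {U. el U \<subseteq> Hom B X Y}"
        "Id (underlying_cat ?Q) = QId ?Q" "Comp (underlying_cat ?Q) = QComp ?Q" for X Y
      by (simp_all add: underlying_cat_def Q)
    have "category (underlying_cat ?Q)"
    proof (rule category.intro, unfold ud mem_Collect_eq)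
      fix X assume "X \<in> Obj B"
      then show "el (QId ?Q X) \<subseteq> Hom B X X" by (simp add: el_id B.id_in_hom)
    next
      fix X Y Z u v
      assume "X \<in> Obj B" "Y \<in> Obj B" "Z \<in> Obj B" "el u \<subseteq> Hom B X Y" "el v \<subseteq> Hom B Y Z"
      then show "el (QComp ?Q X Y Z v u) \<subseteq> Hom B X Z" by (intro comp_hom)
    next
      fix X Y u assume a: "X \<in> Obj B" "Y \<in> Obj B" "el u \<subseteq> Hom B X Y"
      have l: "Comp B X Y Y (Id B Y) f = f" "Comp B X X Y f (Id B X) = f" if "f \<in> el u" for f
        using a that by (auto intro: B.id_left B.id_right)
      show "QComp ?Q X Y Y (QId ?Q Y) u = u"
        using a l(1) B.id_in_hom[of Y] by (intro el_eq) (force simp: el_comp el_id)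
      show "QComp ?Q X X Y u (QId ?Q X) = u"
        using a l(2) B.id_in_hom[of X] by (intro el_eq) (force simp: el_comp el_id)
    next
      fix W X Y Z f g h
      assume a: "W \<in> Obj B" "X \<in> Obj B" "Y \<in> Obj B" "Z \<in> Obj B"
        "el f \<subseteq> Hom B W X" "el g \<subseteq> Hom B X Y" "el h \<subseteq> Hom B Y Z"
      have as: "Comp B W X Z (Comp B X Y Z h' g') f' = Comp B W Y Z h' (Comp B W X Y g' f')"
        if "h' \<in> el h" "g' \<in> el g" "f' \<in> el f" for h' g' f'
        using a that by (intro B.assoc) auto
      have "el (QComp ?Q W X Z (QComp ?Q X Y Z h g) f)
        = {Comp B W X Z (Comp B X Y Z h' g') f' | h' g' f'. h' \<in> el h \<and> g' \<in> el g \<and> f' \<in> el f}"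
        unfolding el_comp[OF a(1,2,4) comp_hom[OF a(2,3,4,7,6)] a(5)] el_comp[OF a(2,3,4,7,6)] by blast
      also have "\<dots> = {Comp B W Y Z h' (Comp B W X Y g' f') | h' g' f'. h' \<in> el h \<and> g' \<in> el g \<and> f' \<in> el f}"
        by (intro Collect_cong) (metis as)
      also have "\<dots> = el (QComp ?Q W Y Z h (QComp ?Q W X Y g f))"
        unfolding el_comp[OF a(1,3,4,7) comp_hom[OF a(1,2,3,6,5)]] el_comp[OF a(1,2,3,6,5)] by blast
      finally show "QComp ?Q W X Z (QComp ?Q X Y Z h g) f = QComp ?Q W Y Z h (QComp ?Q W X Y g f)"
        by (rule el_eq)
    qed
    moreover have "small el (Hom (underlying_cat ?Q) X Y)"
      if XY: "X \<in> Obj (underlying_cat ?Q)" "Y \<in> Obj (underlying_cat ?Q)" for X Y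
    proof -
      obtain v where "Hom B X Y = el v" using B.small_homs[of X Y] XY by (auto simp: small_def ud)
      then show ?thesis using U.powerset[of v] by (simp add: small_def ud)
    qed
    ultimately show "ordinary_category el (underlying_cat ?Q)"
      by (intro ordinary_category.intro ordinary_category_axioms.intro)
  next
    fix X Y assume "X \<in> QObj ?Q" "Y \<in> QObj ?Q"
    then show "complete_lattice (QHom ?Q X Y)" by (simp add: Q lattice)
  next
    fix X Y Z u assume "X \<in> QObj ?Q" "Y \<in> QObj ?Q" "Z \<in> QObj ?Q" "u \<in> carrier (QHom ?Q X Y)"
    then have a: "X \<in> Obj B" "Y \<in> Obj B" "Z \<in> Obj B" "el u \<subseteq> Hom B X Y" by (simp_all add: Q)
    have "QComp ?Q X Y Z (\<Squnion>\<^bsub>QHom ?Q Y Z\<^esub> S) u = (\<Squnion>\<^bsub>QHom ?Q X Z\<^esub> ((\<lambda>v. QComp ?Q X Y Z v u) ` S))"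
      if S: "S \<subseteq> carrier (QHom ?Q Y Z)" for S
    proof (rule el_eq)
      have c: "el v \<subseteq> Hom B Y Z" if "v \<in> S" for v using S that by (auto simp: Q)
      have s: "(\<lambda>v. QComp ?Q X Y Z v u) ` S \<subseteq> carrier (QHom ?Q X Z)"
        unfolding Q using comp_hom[OF a(1-3) c a(4)] by blast
      have t: "el (\<Squnion>\<^bsub>QHom ?Q Y Z\<^esub> S) \<subseteq> Hom B Y Z" unfolding el_sup[OF a(2,3) S] using c by blast
      have "el (QComp ?Q X Y Z (\<Squnion>\<^bsub>QHom ?Q Y Z\<^esub> S) u) = (\<Union>v\<in>S. el (QComp ?Q X Y Z v u))"
        unfolding el_comp[OF a(1-3) t a(4)] el_sup[OF a(2,3) S]
        by (auto simp: el_comp[OF a(1-3) c a(4)])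
      then show "el (QComp ?Q X Y Z (\<Squnion>\<^bsub>QHom ?Q Y Z\<^esub> S) u)
          = el (\<Squnion>\<^bsub>QHom ?Q X Z\<^esub> ((\<lambda>v. QComp ?Q X Y Z v u) ` S))"
        unfolding el_sup[OF a(1,3) s] by simp
    qed
    then show "sup_pres (QHom ?Q Y Z) (QHom ?Q X Z) (\<lambda>v. QComp ?Q X Y Z v u)"
      using a lattice by (simp add: sup_pres_def)
  next
    fix X Y Z v assume "X \<in> QObj ?Q" "Y \<in> QObj ?Q" "Z \<in> QObj ?Q" "v \<in> carrier (QHom ?Q Y Z)"
    then have a: "X \<in> Obj B" "Y \<in> Obj B" "Z \<in> Obj B" "el v \<subseteq> Hom B Y Z" by (simp_all add: Q)
    have "QComp ?Q X Y Z v (\<Squnion>\<^bsub>QHom ?Q X Y\<^esub> S) = (\<Squnion>\<^bsub>QHom ?Q X Z\<^esub> ((\<lambda>u. QComp ?Q X Y Z v u) ` S))"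
      if S: "S \<subseteq> carrier (QHom ?Q X Y)" for S
    proof (rule el_eq)
      have c: "el u \<subseteq> Hom B X Y" if "u \<in> S" for u using S that by (auto simp: Q)
      have s: "(\<lambda>u. QComp ?Q X Y Z v u) ` S \<subseteq> carrier (QHom ?Q X Z)"
        unfolding Q using comp_hom[OF a(1-3) a(4) c] by blast
      have t: "el (\<Squnion>\<^bsub>QHom ?Q X Y\<^esub> S) \<subseteq> Hom B X Y" unfolding el_sup[OF a(1,2) S] using c by blast
      have "el (QComp ?Q X Y Z v (\<Squnion>\<^bsub>QHom ?Q X Y\<^esub> S)) = (\<Union>u\<in>S. el (QComp ?Q X Y Z v u))"
        unfolding el_comp[OF a(1-4) t] el_sup[OF a(1,2) S]
        by (auto simp: el_comp[OF a(1-3) a(4) c])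
      then show "el (QComp ?Q X Y Z v (\<Squnion>\<^bsub>QHom ?Q X Y\<^esub> S))
          = el (\<Squnion>\<^bsub>QHom ?Q X Z\<^esub> ((\<lambda>u. QComp ?Q X Y Z v u) ` S))"
        unfolding el_sup[OF a(1,2) S] el_sup[OF a(1,3) s] by simp
    qed
    then show "sup_pres (QHom ?Q X Y) (QHom ?Q X Z) (QComp ?Q X Y Z v)"
      using a lattice by (simp add: sup_pres_def)
  qed
qed

end

theory Submission
  imports Defs
begin

text \<open>A \<open>\<Q>\<^bsub>B\<^esub>\<close>-category \<open>C\<close> is a set of objects over those of \<open>B\<close> with a set of morphisms of \<open>B\<close> for
  each pair of them, closed under composition and identities. So it is a category \<open>E\<close> with objects
  those of \<open>C\<close> and a functor to \<open>B\<close> whose action on each hom-set is a subset inclusion. Conversely a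
  faithful \<open>p : E \<rightarrow> B\<close> gives the \<open>\<Q>\<^bsub>B\<^esub>\<close>-category with objects those of \<open>E\<close> and with the images
  of the hom-sets under \<open>p\<close> as hom-objects. One round trip is the identity up to the junk values of records;
  the other replaces the hom-sets of \<open>E\<close> by their images, and is isomorphic to the identity because \<open>p\<close>
  is injective on hom-sets. Over a faithful functor to \<open>B\<close>, parallel 1-cells that agree on objects
  are equal and parallel 2-cells are equal, which gives the naturality and functoriality equations.\<close>

section \<open>The 2-category of \<Q>-categories\<close>

text \<open>The two sides match on 2-cells for the following reason. A 2-cell of the slice has every
  component over an identity of \<open>B\<close>. So for a faithful codomain \<open>p'\<close> a
  component from \<open>h x\<close> to \<open>k x\<close> exists, and is then unique, exactly when
  the identity of \<open>p x\<close> lies in the image under \<open>p'\<close> of the hom-set from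
  \<open>h x\<close> to \<open>k x\<close>. That membership is the condition for a transformation of
  enriched functors. Smallness matters because hom-objects are elements of the universe: the image
  of a hom-set of \<open>E\<close> is a subset of a small hom-set of \<open>B\<close>, hence has a
  code. Object sets need no code and may be large. The notion of 2-equivalence includes that both
  sides are strict 2-categories. This is settled for enriched categories over any quantaloid, for
  \<open>CAT\<close>, and for slices and full sub-2-categories of any 2-category.\<close>

lemma sup_pres_mono:
  assumes f: "sup_pres X Y f" "f \<in> carrier X \<rightarrow> carrier Y"
    and uv: "u \<in> carrier X" "v \<in> carrier X" "u \<sqsubseteq>\<^bsub>X\<^esub> v"
  shows "f u \<sqsubseteq>\<^bsub>Y\<^esub> f v"
  \<comment> \<open>If \<open>u\<close> is below \<open>v\<close> then \<open>v\<close> is their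
    join, and \<open>f\<close> preserves that join.\<close>
  using join_pres_isotone[OF f(2) sup_pres_is_join_pres[OF weak_sup_pres[OF f(1)]]] f(1) uv
  by (simp add: sup_pres_def isotone_def)

lemma q_transfs_iff:
  "u \<in> q_transfs Q C D F G \<longleftrightarrow> (\<forall>x\<in>qobj C.
    QId Q (extent C x) \<sqsubseteq>\<^bsub>QHom Q (extent C x) (extent C x)\<^esub> qhom D (F x) (G x))"
  unfolding q_transfs_def by blast

section \<open>Monotonicity of composition, and composites of enriched functors and
  transformations\<close>

context quantaloid
begin

sublocale base: category "underlying_cat Q"
  using cat by (simp add: ordinary_category_def)

lemma id_closed: "X \<in> QObj Q \<Longrightarrow> QId Q X \<in> carrier (QHom Q X X)"
  using base.id_in_hom by (simp add: underlying_cat_def)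

lemma comp_closed:
  "\<lbrakk>X \<in> QObj Q; Y \<in> QObj Q; Z \<in> QObj Q; u \<in> carrier (QHom Q X Y); v \<in> carrier (QHom Q Y Z)\<rbrakk>
    \<Longrightarrow> QComp Q X Y Z v u \<in> carrier (QHom Q X Z)"
  using base.comp_in_hom by (simp add: underlying_cat_def)

lemma id_comp: "\<lbrakk>X \<in> QObj Q; Y \<in> QObj Q; u \<in> carrier (QHom Q X Y)\<rbrakk> \<Longrightarrow> QComp Q X Y Y (QId Q Y) u = u"
  using base.id_left by (simp add: underlying_cat_def)

lemma le_trans:
  assumes "X \<in> QObj Q" "Y \<in> QObj Q"
    "u \<in> carrier (QHom Q X Y)" "v \<in> carrier (QHom Q X Y)" "w \<in> carrier (QHom Q X Y)"
    "u \<sqsubseteq>\<^bsub>QHom Q X Y\<^esub> v" "v \<sqsubseteq>\<^bsub>QHom Q X Y\<^esub> w"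
  shows "u \<sqsubseteq>\<^bsub>QHom Q X Y\<^esub> w"
proof -
  interpret complete_lattice "QHom Q X Y" using assms by (intro hom_lattice)
  show ?thesis using assms le_trans by blast
qed

lemma le_refl:
  assumes "X \<in> QObj Q" "Y \<in> QObj Q" "u \<in> carrier (QHom Q X Y)"
  shows "u \<sqsubseteq>\<^bsub>QHom Q X Y\<^esub> u"
proof -
  interpret complete_lattice "QHom Q X Y" using assms by (intro hom_lattice)
  show ?thesis using assms le_refl by blast
qed

text \<open>One argument is moved at a time, through the composite of \<open>v'\<close> and
  \<open>u\<close>, since the quantaloid axioms speak of joins in each variable separately.\<close>

lemma comp_mono:
  assumes XYZ: "X \<in> QObj Q" "Y \<in> QObj Q" "Z \<in> QObj Q"
    and u: "u \<in> carrier (QHom Q X Y)" "u' \<in> carrier (QHom Q X Y)" "u \<sqsubseteq>\<^bsub>QHom Q X Y\<^esub> u'"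
    and v: "v \<in> carrier (QHom Q Y Z)" "v' \<in> carrier (QHom Q Y Z)" "v \<sqsubseteq>\<^bsub>QHom Q Y Z\<^esub> v'"
  shows "QComp Q X Y Z v u \<sqsubseteq>\<^bsub>QHom Q X Z\<^esub> QComp Q X Y Z v' u'"
proof (rule le_trans)
  show "QComp Q X Y Z v u \<sqsubseteq>\<^bsub>QHom Q X Z\<^esub> QComp Q X Y Z v' u"
    using XYZ u(1) v by (intro sup_pres_mono[OF comp_sup_left]) (auto intro: comp_closed)
  show "QComp Q X Y Z v' u \<sqsubseteq>\<^bsub>QHom Q X Z\<^esub> QComp Q X Y Z v' u'"
    using XYZ u v(2) by (intro sup_pres_mono[OF comp_sup_right]) (auto intro: comp_closed)
qed (use assms in \<open>auto intro: comp_closed\<close>)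

text \<open>The identity is the composite of two identities, and composition is monotone.\<close>

lemma id_le_comp:
  assumes "X \<in> QObj Q" and u: "u \<in> carrier (QHom Q X X)" "QId Q X \<sqsubseteq>\<^bsub>QHom Q X X\<^esub> u"
    and v: "v \<in> carrier (QHom Q X X)" "QId Q X \<sqsubseteq>\<^bsub>QHom Q X X\<^esub> v"
  shows "QId Q X \<sqsubseteq>\<^bsub>QHom Q X X\<^esub> QComp Q X X X v u"
  using comp_mono[of X X X "QId Q X" u "QId Q X" v] assms by (simp add: id_closed id_comp)

lemma q_functorD:
  assumes "F \<in> q_functors Q C D"
  shows "x \<in> qobj C \<Longrightarrow> F x \<in> qobj D"
    and "x \<in> qobj C \<Longrightarrow> extent D (F x) = extent C x"
    and "\<lbrakk>x \<in> qobj C; y \<in> qobj C\<rbrakk>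
      \<Longrightarrow> qhom C x y \<sqsubseteq>\<^bsub>QHom Q (extent C x) (extent C y)\<^esub> qhom D (F x) (F y)"
    and "F \<in> extensional (qobj C)"
  using assms by (auto simp: q_functors_def PiE_def)

text \<open>Both functors preserve extents, so this hom-object lies over extents taken in
  \<open>C\<close>, and inequalities about transformations can be chained in a single
  lattice.\<close>

lemma q_functor_hom:
  assumes "q_category Q D" "F \<in> q_functors Q C D" "G \<in> q_functors Q C D" "x \<in> qobj C" "y \<in> qobj C"
  shows "qhom D (F x) (G y) \<in> carrier (QHom Q (extent C x) (extent C y))"
  using q_category.hom[OF assms(1), of "F x" "G y"] q_functorD[OF assms(2)] q_functorD[OF assms(3)] assms(4,5)
  by simp

lemma q_functor_comp:
  assumes "q_category Q C" "q_category Q D" "q_category Q E"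
    and F: "F \<in> q_functors Q C D" and G: "G \<in> q_functors Q D E"
  shows "compose (qobj C) G F \<in> q_functors Q C E"
proof -
  interpret C: q_category Q C by fact
  interpret D: q_category Q D by fact
  interpret E: q_category Q E by fact
  have "qhom C x y \<sqsubseteq>\<^bsub>QHom Q (extent C x) (extent C y)\<^esub> qhom E (G (F x)) (G (F y))"
    if xy: "x \<in> qobj C" "y \<in> qobj C" for x y
  proof (rule le_trans[OF C.extent[OF xy(1)] C.extent[OF xy(2)] C.hom[OF xy]])
    note F' = q_functorD[OF F] and G' = q_functorD[OF G]
    show "qhom D (F x) (F y) \<in> carrier (QHom Q (extent C x) (extent C y))"
      using D.hom[of "F x" "F y"] xy by (simp add: F')
    show "qhom E (G (F x)) (G (F y)) \<in> carrier (QHom Q (extent C x) (extent C y))"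
      using E.hom[of "G (F x)" "G (F y)"] xy by (simp add: F' G')
    show "qhom C x y \<sqsubseteq>\<^bsub>QHom Q (extent C x) (extent C y)\<^esub> qhom D (F x) (F y)"
      using xy by (rule F'(3))
    show "qhom D (F x) (F y) \<sqsubseteq>\<^bsub>QHom Q (extent C x) (extent C y)\<^esub> qhom E (G (F x)) (G (F y))"
      using G'(3)[of "F x" "F y"] xy by (simp add: F')
  qed
  then show ?thesis using q_functorD(1,2)[OF F] q_functorD(1,2)[OF G]
    by (simp add: q_functors_def compose_def)
qed

text \<open>Vertical composition: the identity is below the composite of \<open>D(Gx,Hx)\<close> and
  \<open>D(Fx,Gx)\<close>, which the composition law of \<open>D\<close> puts below
  \<open>D(Fx,Hx)\<close>.\<close>

lemma q_transf_trans:
  assumes "q_category Q C" "q_category Q D"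
    and F: "F \<in> q_functors Q C D" and G: "G \<in> q_functors Q C D" and H: "H \<in> q_functors Q C D"
    and "() \<in> q_transfs Q C D F G" "() \<in> q_transfs Q C D G H"
  shows "() \<in> q_transfs Q C D F H"
proof -
  interpret C: q_category Q C by fact
  interpret D: q_category Q D by fact
  have "QId Q (extent C x) \<sqsubseteq>\<^bsub>QHom Q (extent C x) (extent C x)\<^esub> qhom D (F x) (H x)"
    if x: "x \<in> qobj C" for x
  proof -
    let ?X = "extent C x"
    have X: "?X \<in> QObj Q" using x by (rule C.extent)
    have c: "qhom D (F x) (G x) \<in> carrier (QHom Q ?X ?X)" "qhom D (G x) (H x) \<in> carrier (QHom Q ?X ?X)"
      "qhom D (F x) (H x) \<in> carrier (QHom Q ?X ?X)"
      by (rule q_functor_hom[OF assms(2) F G x x] q_functor_hom[OF assms(2) G H x x]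
          q_functor_hom[OF assms(2) F H x x])+
    have "QId Q ?X \<sqsubseteq>\<^bsub>QHom Q ?X ?X\<^esub> QComp Q ?X ?X ?X (qhom D (G x) (H x)) (qhom D (F x) (G x))"
      using assms(6,7) x X c by (intro id_le_comp) (auto simp: q_transfs_iff)
    moreover have "QComp Q ?X ?X ?X (qhom D (G x) (H x)) (qhom D (F x) (G x)) \<sqsubseteq>\<^bsub>QHom Q ?X ?X\<^esub> qhom D (F x) (H x)"
      using D.comp[of "F x" "G x" "H x"] q_functorD[OF F] q_functorD[OF G] q_functorD[OF H] x by simp
    ultimately show ?thesis
      by (rule le_trans[OF X X id_closed[OF X] comp_closed[OF X X X c(1,2)] c(3)])
  qed
  then show ?thesis by (simp add: q_transfs_iff)
qed

text \<open>The path runs through the composite of \<open>G\<close> and \<open>F'\<close>: one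
  whiskering applies \<open>G\<close> to the first transformation, the other evaluates the second
  one at \<open>F' x\<close>, and vertical composition joins them.\<close>

lemma q_transf_hcomp:
  assumes "q_category Q C" "q_category Q D" "q_category Q E"
    and F: "F \<in> q_functors Q C D" "F' \<in> q_functors Q C D" "() \<in> q_transfs Q C D F F'"
    and G: "G \<in> q_functors Q D E" "G' \<in> q_functors Q D E" "() \<in> q_transfs Q D E G G'"
  shows "() \<in> q_transfs Q C E (compose (qobj C) G F) (compose (qobj C) G' F')"
proof (rule q_transf_trans[OF assms(1,3)])
  interpret C: q_category Q C by fact
  interpret D: q_category Q D by fact
  interpret E: q_category Q E by fact
  note f = q_functorD(1,2)[OF F(1)] q_functorD(1,2)[OF F(2)] q_functorD(1,2)[OF G(1)] q_functorD(1,2)[OF G(2)]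
  show "compose (qobj C) G F \<in> q_functors Q C E" "compose (qobj C) G F' \<in> q_functors Q C E"
    "compose (qobj C) G' F' \<in> q_functors Q C E"
    using assms by (auto intro: q_functor_comp)
  show "() \<in> q_transfs Q C E (compose (qobj C) G F) (compose (qobj C) G F')"
    unfolding q_transfs_iff
  proof
    fix x assume x: "x \<in> qobj C"
    let ?X = "extent C x"
    have "QId Q ?X \<sqsubseteq>\<^bsub>QHom Q ?X ?X\<^esub> qhom D (F x) (F' x)" using F(3) x by (simp add: q_transfs_iff)
    moreover have "qhom D (F x) (F' x) \<sqsubseteq>\<^bsub>QHom Q ?X ?X\<^esub> qhom E (G (F x)) (G (F' x))"
      using q_functorD(3)[OF G(1), of "F x" "F' x"] x by (simp add: f)
    moreover have "qhom E (G (F x)) (G (F' x)) \<in> carrier (QHom Q ?X ?X)"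
      using E.hom[of "G (F x)" "G (F' x)"] x by (simp add: f)
    ultimately show "QId Q ?X \<sqsubseteq>\<^bsub>QHom Q ?X ?X\<^esub> qhom E (compose (qobj C) G F x) (compose (qobj C) G F' x)"
      using le_trans[OF C.extent[OF x] C.extent[OF x] id_closed[OF C.extent[OF x]] q_functor_hom[OF assms(2) F(1,2) x x]] x
      by (simp add: compose_def)
  qed
  show "() \<in> q_transfs Q C E (compose (qobj C) G F') (compose (qobj C) G' F')"
    unfolding q_transfs_iff
  proof
    fix x assume "x \<in> qobj C"
    then show "QId Q (extent C x) \<sqsubseteq>\<^bsub>QHom Q (extent C x) (extent C x)\<^esub>
        qhom E (compose (qobj C) G F' x) (compose (qobj C) G' F' x)"
      using G(3)[unfolded q_transfs_iff, rule_format, of "F' x"] by (simp add: compose_def f)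
  qed
qed

text \<open>Transformations are elements of \<open>unit\<close>, so for 2-cells only existence has
  content: identities and both kinds of composites must exist.\<close>

lemma two_category_QCAT: "two_category (QCAT Q :: (('x, 'o, 'v) qcat, 'x \<Rightarrow> 'x, unit) cat2)"
proof (rule two_category.intro, unfold QCAT_def cat2.simps mem_Collect_eq cat.simps ftor.simps prod.case)
  fix C D :: "('x, 'o, 'v) qcat" assume CD: "q_category Q C" "q_category Q D"
  interpret C: q_category Q C by fact
  interpret D: q_category Q D by fact
  show "category \<lparr>Obj = q_functors Q C D, Hom = q_transfs Q C D, Id = \<lambda>F. (), Comp = \<lambda>F G H \<beta> \<alpha>. ()\<rparr>"
  proof (unfold_locales, unfold cat.simps)
    fix F assume F: "F \<in> q_functors Q C D"
    then show "() \<in> q_transfs Q C D F F"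
      using q_functorD[OF F] D.unit by (force simp: q_transfs_iff)
  qed (use CD in \<open>auto intro: q_transf_trans\<close>)
next
  fix C :: "('x, 'o, 'v) qcat" assume C: "q_category Q C"
  interpret C: q_category Q C by fact
  show "(\<lambda>x\<in>qobj C. x) \<in> q_functors Q C C"
    using C.extent C.hom by (auto simp: q_functors_def intro: le_refl)
next
  fix C D E :: "('x, 'o, 'v) qcat" assume "q_category Q C" "q_category Q D" "q_category Q E"
  then show "is_functor
     (prod_cat \<lparr>Obj = q_functors Q D E, Hom = q_transfs Q D E, Id = \<lambda>F. (), Comp = \<lambda>F G H \<beta> \<alpha>. ()\<rparr>
       \<lparr>Obj = q_functors Q C D, Hom = q_transfs Q C D, Id = \<lambda>F. (), Comp = \<lambda>F G H \<beta> \<alpha>. ()\<rparr>)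
     \<lparr>Obj = q_functors Q C E, Hom = q_transfs Q C E, Id = \<lambda>F. (), Comp = \<lambda>F G H \<beta> \<alpha>. ()\<rparr>
     \<lparr>fobj = \<lambda>(G, F). compose (qobj C) G F, fmor = \<lambda>GF GF' \<beta>\<alpha>. ()\<rparr>"
    by unfold_locales (auto simp: prod_cat_def intro: q_functor_comp q_transf_hcomp)
next
  fix C D :: "('x, 'o, 'v) qcat" and F assume "q_category Q C" "q_category Q D" and F: "F \<in> q_functors Q C D"
  show "compose (qobj C) (\<lambda>x\<in>qobj D. x) F = F"
    using q_functorD[OF F] by (intro extensionalityI[of _ "qobj C"]) (auto simp: compose_def)
  show "compose (qobj C) F (\<lambda>x\<in>qobj C. x) = F"
    using q_functorD[OF F] by (intro extensionalityI[of _ "qobj C"]) (auto simp: compose_def)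
next
  fix C D :: "('x, 'o, 'v) qcat" and F G H :: "'x \<Rightarrow> 'x" assume F: "F \<in> q_functors Q C D"
  show "compose (qobj C) (compose (qobj D) H G) F = compose (qobj C) H (compose (qobj C) G F)"
    using q_functorD[OF F] by (auto simp: compose_def)
\<comment> \<open>What is left are the unit and associativity equations of 2-cells, all between
  elements of \<open>unit\<close>.\<close>
qed (rule trans[OF unit_eq unit_eq[symmetric]])+

end

section \<open>The 2-category of categories\<close>

lemma prod_cat_simps [simp]:
  "Obj (prod_cat C D) = Obj C \<times> Obj D"
  "Hom (prod_cat C D) (x, y) (x', y') = Hom C x x' \<times> Hom D y y'"
  "Id (prod_cat C D) (x, y) = (Id C x, Id D y)"
  "Comp (prod_cat C D) (x, y) (x', y') (x'', y'') (g, k) (f, h) =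
    (Comp C x x' x'' g f, Comp D y y' y'' k h)"
  by (simp_all add: prod_cat_def)

lemma functor_cat_simps [simp]:
  "Obj (functor_cat C D) = functors C D"
  "Hom (functor_cat C D) = nat_transfs C D"
  "Id (functor_cat C D) F = (\<lambda>x\<in>Obj C. Id D (fobj F x))"
  "Comp (functor_cat C D) F G H \<beta> \<alpha> = (\<lambda>x\<in>Obj C. Comp D (fobj F x) (fobj G x) (fobj H x) (\<beta> x) (\<alpha> x))"
  by (simp_all add: functor_cat_def)

lemma CAT_simps [simp]:
  "Obj2 (CAT el) = {C. ordinary_category el C}"
  "Hom2 (CAT el) = functor_cat"
  "Id2 (CAT el) C = restrict_ftor C id_ftor"
  "comp1 (CAT el) C D E G F = restrict_ftor C (comp_ftor G F)"
  "hcomp (CAT el) C D E G G' F F' \<beta> \<alpha> = (\<lambda>x\<in>Obj C.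
    Comp E (fobj G (fobj F x)) (fobj G (fobj F' x)) (fobj G' (fobj F' x))
      (\<beta> (fobj F' x)) (fmor G (fobj F x) (fobj F' x) (\<alpha> x)))"
  by (simp_all add: CAT_def)

lemma restrict_ftor_simps [simp]:
  "x \<in> Obj C \<Longrightarrow> fobj (restrict_ftor C F) x = fobj F x"
  "\<lbrakk>x \<in> Obj C; y \<in> Obj C; f \<in> Hom C x y\<rbrakk> \<Longrightarrow> fmor (restrict_ftor C F) x y f = fmor F x y f"
  by (simp_all add: restrict_ftor_def)

lemma restrict_ftor_cong:
  assumes "\<And>x. x \<in> Obj C \<Longrightarrow> fobj F x = fobj G x"
    and "\<And>x y f. \<lbrakk>x \<in> Obj C; y \<in> Obj C; f \<in> Hom C x y\<rbrakk> \<Longrightarrow> fmor F x y f = fmor G x y f"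
  shows "restrict_ftor C F = restrict_ftor C G"
  using assms by (auto simp: restrict_ftor_def fun_eq_iff)

lemma id_ftor_simps [simp]: "fobj id_ftor x = x" "fmor id_ftor x y f = f"
  by (simp_all add: id_ftor_def)

lemma comp_ftor_simps [simp]:
  "fobj (comp_ftor G F) x = fobj G (fobj F x)"
  "fmor (comp_ftor G F) x y f = fmor G (fobj F x) (fobj F y) (fmor F x y f)"
  by (simp_all add: comp_ftor_def)

lemma is_functor_restrict_ftor:
  assumes "category C" and "is_functor C D F"
  shows "is_functor C D (restrict_ftor C F)"
proof -
  interpret C: category C by fact
  interpret F: is_functor C D F by fact
  show ?thesis
    by unfold_locales (simp_all add: F.obj F.mor F.pres_id F.pres_comp C.id_in_hom C.comp_in_hom)
qed

lemma restrict_ftor_in_functors: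
  assumes "category C" and "is_functor C D F"
  shows "restrict_ftor C F \<in> functors C D"
proof -
  have "restrict_ftor C (restrict_ftor C F) = restrict_ftor C F"
    by (auto simp: restrict_ftor_def fun_eq_iff)
  then show ?thesis using is_functor_restrict_ftor[OF assms] by (simp add: functors_def)
qed

lemma functors_is_functor: "F \<in> functors C D \<Longrightarrow> is_functor C D F"
  by (simp add: functors_def)

text \<open>Functors are normalised outside their domain, so agreement on the domain is equality of
  records. The codomains may differ because the record does not mention its codomain.\<close>

lemma functors_eqI:
  assumes "F \<in> functors C D" and "G \<in> functors C D'"
    and "\<And>x. x \<in> Obj C \<Longrightarrow> fobj F x = fobj G x"
    and "\<And>x y f. \<lbrakk>x \<in> Obj C; y \<in> Obj C; f \<in> Hom C x y\<rbrakk> \<Longrightarrow> fmor F x y f = fmor G x y f"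
  shows "F = G"
proof -
  have "restrict_ftor C F = restrict_ftor C G"
    by (rule restrict_ftor_cong) (simp_all add: assms(3,4))
  then show ?thesis using assms(1,2) by (simp add: functors_def)
qed

lemma is_functor_id_ftor: "is_functor C C id_ftor"
  by unfold_locales simp_all

lemma is_functor_comp_ftor:
  assumes "is_functor C D F" and "is_functor D E G"
  shows "is_functor C E (comp_ftor G F)"
proof -
  interpret F: is_functor C D F by fact
  interpret G: is_functor D E G by fact
  show ?thesis
    by unfold_locales
      (simp_all add: F.obj F.mor F.pres_id F.pres_comp G.obj G.mor G.pres_id G.pres_comp)
qed

lemma is_functor_prod_catI:
  assumes "\<And>x y. \<lbrakk>x \<in> Obj C; y \<in> Obj D\<rbrakk> \<Longrightarrow> fobj F (x, y) \<in> Obj E"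
    and "\<And>x y x' y' f g. \<lbrakk>x \<in> Obj C; x' \<in> Obj C; f \<in> Hom C x x'; y \<in> Obj D; y' \<in> Obj D; g \<in> Hom D y y'\<rbrakk>
      \<Longrightarrow> fmor F (x, y) (x', y') (f, g) \<in> Hom E (fobj F (x, y)) (fobj F (x', y'))"
    and "\<And>x y. \<lbrakk>x \<in> Obj C; y \<in> Obj D\<rbrakk>
      \<Longrightarrow> fmor F (x, y) (x, y) (Id C x, Id D y) = Id E (fobj F (x, y))"
    and "\<And>x y x' y' x'' y'' f g f' g'.
      \<lbrakk>x \<in> Obj C; x' \<in> Obj C; x'' \<in> Obj C; f \<in> Hom C x x'; f' \<in> Hom C x' x'';
        y \<in> Obj D; y' \<in> Obj D; y'' \<in> Obj D; g \<in> Hom D y y'; g' \<in> Hom D y' y''\<rbrakk>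
      \<Longrightarrow> fmor F (x, y) (x'', y'') (Comp C x x' x'' f' f, Comp D y y' y'' g' g)
        = Comp E (fobj F (x, y)) (fobj F (x', y')) (fobj F (x'', y''))
            (fmor F (x', y') (x'', y'') (f', g')) (fmor F (x, y) (x', y') (f, g))"
  shows "is_functor (prod_cat C D) E F"
  by unfold_locales (use assms in auto)

lemma nat_transfsI:
  assumes "\<alpha> \<in> extensional (Obj C)"
    and "\<And>x. x \<in> Obj C \<Longrightarrow> \<alpha> x \<in> Hom D (fobj F x) (fobj G x)"
    and "\<And>x y f. \<lbrakk>x \<in> Obj C; y \<in> Obj C; f \<in> Hom C x y\<rbrakk>
      \<Longrightarrow> Comp D (fobj F x) (fobj F y) (fobj G y) (\<alpha> y) (fmor F x y f)
        = Comp D (fobj F x) (fobj G x) (fobj G y) (fmor G x y f) (\<alpha> x)"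
  shows "\<alpha> \<in> nat_transfs C D F G"
  using assms by (simp add: nat_transfs_def)

lemma nat_transfsD:
  assumes "\<alpha> \<in> nat_transfs C D F G"
  shows "\<alpha> \<in> extensional (Obj C)"
    and "x \<in> Obj C \<Longrightarrow> \<alpha> x \<in> Hom D (fobj F x) (fobj G x)"
    and "\<lbrakk>x \<in> Obj C; y \<in> Obj C; f \<in> Hom C x y\<rbrakk>
      \<Longrightarrow> Comp D (fobj F x) (fobj F y) (fobj G y) (\<alpha> y) (fmor F x y f)
        = Comp D (fobj F x) (fobj G x) (fobj G y) (fmor G x y f) (\<alpha> x)"
  using assms by (simp_all add: nat_transfs_def)

section \<open>Pasting of commuting diagrams\<close>

context category
begin

text \<open>Stacks two commuting squares. Naturality of vertical composites and naturality of
  horizontal composites are both instances.\<close>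

lemma paste_squares:
  assumes "x \<in> Obj C" "x' \<in> Obj C" "x'' \<in> Obj C" "y \<in> Obj C" "y' \<in> Obj C" "y'' \<in> Obj C"
    and "f \<in> Hom C x y" "g \<in> Hom C x' y'" "h \<in> Hom C x'' y''"
    and "a \<in> Hom C x x'" "b \<in> Hom C y y'" "a' \<in> Hom C x' x''" "b' \<in> Hom C y' y''"
    and "Comp C x y y' b f = Comp C x x' y' g a"
    and "Comp C x' y' y'' b' g = Comp C x' x'' y'' h a'"
  shows "Comp C x y y'' (Comp C y y' y'' b' b) f = Comp C x x'' y'' h (Comp C x x' x'' a' a)"
proof -
  have "Comp C x y y'' (Comp C y y' y'' b' b) f = Comp C x y' y'' b' (Comp C x x' y' g a)"
    using assms by (simp add: assoc)
  also have "\<dots> = Comp C x x' y'' (Comp C x' x'' y'' h a') a"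
    using assms by (metis assoc)
  also have "\<dots> = Comp C x x'' y'' h (Comp C x x' x'' a' a)"
    using assms by (simp add: assoc)
  finally show ?thesis .
qed

text \<open>In the string \<open>b' b a' a\<close> the inner pair \<open>b a'\<close> is exchanged
  for \<open>c d\<close>. In the interchange law this exchange is a naturality square.\<close>

lemma middle_four_interchange:
  assumes "v \<in> Obj C" "w \<in> Obj C" "x \<in> Obj C" "x' \<in> Obj C" "y \<in> Obj C" "z \<in> Obj C"
    and "a \<in> Hom C v w" "a' \<in> Hom C w x" "b \<in> Hom C x y" "b' \<in> Hom C y z"
    and "c \<in> Hom C x' y" "d \<in> Hom C w x'" "Comp C w x y b a' = Comp C w x' y c d"
  shows "Comp C v x z (Comp C x y z b' b) (Comp C v w x a' a)
    = Comp C v x' z (Comp C x' y z b' c) (Comp C v w x' d a)"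
proof -
  have "Comp C v x z (Comp C x y z b' b) (Comp C v w x a' a)
      = Comp C v y z b' (Comp C v w y (Comp C w x y b a') a)"
    using assms(1-12) by (simp add: assoc comp_in_hom)
  also have "\<dots> = Comp C v x' z (Comp C x' y z b' c) (Comp C v w x' d a)"
    unfolding assms(13) using assms(1-12) by (simp add: assoc comp_in_hom)
  finally show ?thesis .
qed

end

lemma category_functor_cat:
  assumes "category C" "category D"
  shows "category (functor_cat C D)"
proof -
  interpret D: category D by fact
  show ?thesis
  proof (rule category.intro, unfold functor_cat_simps)
    fix F assume "F \<in> functors C D"
    then interpret F: is_functor C D F by (rule functors_is_functor)
    show "(\<lambda>x\<in>Obj C. Id D (fobj F x)) \<in> nat_transfs C D F F"
      by (rule nat_transfsI)
        (simp_all add: D.id_in_hom F.obj D.id_left[OF _ _ F.mor] D.id_right[OF _ _ F.mor])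
  next
    fix F G H \<alpha> \<beta> assume "F \<in> functors C D" "G \<in> functors C D" "H \<in> functors C D"
      and a: "\<alpha> \<in> nat_transfs C D F G" and b: "\<beta> \<in> nat_transfs C D G H"
    then interpret F: is_functor C D F + G: is_functor C D G + H: is_functor C D H
      by (simp_all add: functors_is_functor)
    show "(\<lambda>x\<in>Obj C. Comp D (fobj F x) (fobj G x) (fobj H x) (\<beta> x) (\<alpha> x)) \<in> nat_transfs C D F H"
    proof (rule nat_transfsI)
      fix x y f assume x: "x \<in> Obj C" "y \<in> Obj C" "f \<in> Hom C x y"
      have "Comp D (fobj F x) (fobj F y) (fobj H y) (Comp D (fobj F y) (fobj G y) (fobj H y) (\<beta> y) (\<alpha> y)) (fmor F x y f)
        = Comp D (fobj F x) (fobj H x) (fobj H y) (fmor H x y f) (Comp D (fobj F x) (fobj G x) (fobj H x) (\<beta> x) (\<alpha> x))"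
        by (rule D.paste_squares[OF F.obj G.obj H.obj F.obj G.obj H.obj F.mor G.mor H.mor
              nat_transfsD(2)[OF a] nat_transfsD(2)[OF a] nat_transfsD(2)[OF b] nat_transfsD(2)[OF b]
              nat_transfsD(3)[OF a] nat_transfsD(3)[OF b]])
          (simp_all add: x)
      then show "Comp D (fobj F x) (fobj F y) (fobj H y)
          ((\<lambda>x\<in>Obj C. Comp D (fobj F x) (fobj G x) (fobj H x) (\<beta> x) (\<alpha> x)) y) (fmor F x y f)
        = Comp D (fobj F x) (fobj H x) (fobj H y) (fmor H x y f)
          ((\<lambda>x\<in>Obj C. Comp D (fobj F x) (fobj G x) (fobj H x) (\<beta> x) (\<alpha> x)) x)"
        using x by simp
    qed (simp_all add: D.comp_in_hom[OF F.obj G.obj H.obj] nat_transfsD(2)[OF a] nat_transfsD(2)[OF b])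
  next
    fix F G \<alpha> assume "F \<in> functors C D" "G \<in> functors C D" and a: "\<alpha> \<in> nat_transfs C D F G"
    then interpret F: is_functor C D F + G: is_functor C D G by (simp_all add: functors_is_functor)
    show "(\<lambda>x\<in>Obj C. Comp D (fobj F x) (fobj G x) (fobj G x) ((\<lambda>x\<in>Obj C. Id D (fobj G x)) x) (\<alpha> x)) = \<alpha>"
      by (rule extensionalityI[of _ "Obj C"])
        (simp_all add: nat_transfsD[OF a] D.id_left[OF F.obj G.obj nat_transfsD(2)[OF a]])
    show "(\<lambda>x\<in>Obj C. Comp D (fobj F x) (fobj F x) (fobj G x) (\<alpha> x) ((\<lambda>x\<in>Obj C. Id D (fobj F x)) x)) = \<alpha>"
      by (rule extensionalityI[of _ "Obj C"])
        (simp_all add: nat_transfsD[OF a] D.id_right[OF F.obj G.obj nat_transfsD(2)[OF a]])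
  next
    fix F G H K \<alpha> \<beta> \<gamma>
    assume "F \<in> functors C D" "G \<in> functors C D" "H \<in> functors C D" "K \<in> functors C D"
      and a: "\<alpha> \<in> nat_transfs C D F G" and b: "\<beta> \<in> nat_transfs C D G H" and c: "\<gamma> \<in> nat_transfs C D H K"
    then interpret F: is_functor C D F + G: is_functor C D G + H: is_functor C D H + K: is_functor C D K
      by (simp_all add: functors_is_functor)
    show "(\<lambda>x\<in>Obj C. Comp D (fobj F x) (fobj G x) (fobj K x)
        ((\<lambda>x\<in>Obj C. Comp D (fobj G x) (fobj H x) (fobj K x) (\<gamma> x) (\<beta> x)) x) (\<alpha> x))
      = (\<lambda>x\<in>Obj C. Comp D (fobj F x) (fobj H x) (fobj K x) (\<gamma> x)
        ((\<lambda>x\<in>Obj C. Comp D (fobj F x) (fobj G x) (fobj H x) (\<beta> x) (\<alpha> x)) x))"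
      by (rule restrict_ext)
        (simp add: D.assoc[OF F.obj G.obj H.obj K.obj] nat_transfsD(2)[OF a] nat_transfsD(2)[OF b] nat_transfsD(2)[OF c])
  qed
qed

lemma is_functor_CAT_comp:
  assumes "category C" "category D" "category E"
  shows "is_functor (prod_cat (functor_cat D E) (functor_cat C D)) (functor_cat C E) (Comp2 (CAT el) C D E)"
proof (rule is_functor_prod_catI, unfold functor_cat_simps CAT_simps)
  interpret D: category D by fact
  interpret E: category E by fact
  {
    fix G F assume "G \<in> functors D E" "F \<in> functors C D"
    then show "restrict_ftor C (comp_ftor G F) \<in> functors C E"
      using assms(1) by (intro restrict_ftor_in_functors is_functor_comp_ftor functors_is_functor)
  next
    fix G F G' F' \<beta> \<alpha>
    assume "G \<in> functors D E" "G' \<in> functors D E" "F \<in> functors C D" "F' \<in> functors C D"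
      and b: "\<beta> \<in> nat_transfs D E G G'" and a: "\<alpha> \<in> nat_transfs C D F F'"
    then interpret F: is_functor C D F + F': is_functor C D F' + G: is_functor D E G + G': is_functor D E G'
      by (simp_all add: functors_is_functor)
    note o = F.obj F'.obj G.obj G'.obj
    note A = nat_transfsD(2)[OF a] and B = nat_transfsD(2)[OF b]
    show "(\<lambda>x\<in>Obj C. Comp E (fobj G (fobj F x)) (fobj G (fobj F' x)) (fobj G' (fobj F' x))
        (\<beta> (fobj F' x)) (fmor G (fobj F x) (fobj F' x) (\<alpha> x)))
      \<in> nat_transfs C E (restrict_ftor C (comp_ftor G F)) (restrict_ftor C (comp_ftor G' F'))"
    proof (rule nat_transfsI)
      fix x y f assume x: "x \<in> Obj C" "y \<in> Obj C" "f \<in> Hom C x y"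
      \<comment> \<open>This is \<open>G\<close> applied to the naturality square of \<alpha>. It is
        to be stacked with the naturality square of \<beta> at the morphism
        \<open>F' f\<close>.\<close>
      have "Comp E (fobj G (fobj F x)) (fobj G (fobj F y)) (fobj G (fobj F' y))
          (fmor G (fobj F y) (fobj F' y) (\<alpha> y)) (fmor G (fobj F x) (fobj F y) (fmor F x y f))
        = Comp E (fobj G (fobj F x)) (fobj G (fobj F' x)) (fobj G (fobj F' y))
          (fmor G (fobj F' x) (fobj F' y) (fmor F' x y f)) (fmor G (fobj F x) (fobj F' x) (\<alpha> x))"
        using nat_transfsD(3)[OF a x] x by (simp add: G.pres_comp[symmetric] o A F.mor F'.mor)
      moreover have "Comp E (fobj G (fobj F' x)) (fobj G (fobj F' y)) (fobj G' (fobj F' y))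
          (\<beta> (fobj F' y)) (fmor G (fobj F' x) (fobj F' y) (fmor F' x y f))
        = Comp E (fobj G (fobj F' x)) (fobj G' (fobj F' x)) (fobj G' (fobj F' y))
          (fmor G' (fobj F' x) (fobj F' y) (fmor F' x y f)) (\<beta> (fobj F' x))"
        by (rule nat_transfsD(3)[OF b F'.obj F'.obj F'.mor]) (simp_all add: x)
      ultimately have "Comp E (fobj G (fobj F x)) (fobj G (fobj F y)) (fobj G' (fobj F' y))
          (Comp E (fobj G (fobj F y)) (fobj G (fobj F' y)) (fobj G' (fobj F' y))
            (\<beta> (fobj F' y)) (fmor G (fobj F y) (fobj F' y) (\<alpha> y)))
          (fmor G (fobj F x) (fobj F y) (fmor F x y f))
        = Comp E (fobj G (fobj F x)) (fobj G' (fobj F' x)) (fobj G' (fobj F' y))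
          (fmor G' (fobj F' x) (fobj F' y) (fmor F' x y f))
          (Comp E (fobj G (fobj F x)) (fobj G (fobj F' x)) (fobj G' (fobj F' x))
            (\<beta> (fobj F' x)) (fmor G (fobj F x) (fobj F' x) (\<alpha> x)))"
        using x by (intro E.paste_squares) (simp_all add: o G.mor G'.mor A B F.mor F'.mor)
      then show "Comp E (fobj (restrict_ftor C (comp_ftor G F)) x) (fobj (restrict_ftor C (comp_ftor G F)) y)
          (fobj (restrict_ftor C (comp_ftor G' F')) y)
          ((\<lambda>x\<in>Obj C. Comp E (fobj G (fobj F x)) (fobj G (fobj F' x)) (fobj G' (fobj F' x))
            (\<beta> (fobj F' x)) (fmor G (fobj F x) (fobj F' x) (\<alpha> x))) y)
          (fmor (restrict_ftor C (comp_ftor G F)) x y f)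
        = Comp E (fobj (restrict_ftor C (comp_ftor G F)) x) (fobj (restrict_ftor C (comp_ftor G' F')) x)
          (fobj (restrict_ftor C (comp_ftor G' F')) y)
          (fmor (restrict_ftor C (comp_ftor G' F')) x y f)
          ((\<lambda>x\<in>Obj C. Comp E (fobj G (fobj F x)) (fobj G (fobj F' x)) (fobj G' (fobj F' x))
            (\<beta> (fobj F' x)) (fmor G (fobj F x) (fobj F' x) (\<alpha> x))) x)"
        using x by simp
    qed (simp_all add: E.comp_in_hom o A B G.mor)
  next
    fix G F assume "G \<in> functors D E" "F \<in> functors C D"
    then interpret F: is_functor C D F + G: is_functor D E G by (simp_all add: functors_is_functor)
    show "(\<lambda>x\<in>Obj C. Comp E (fobj G (fobj F x)) (fobj G (fobj F x)) (fobj G (fobj F x))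
        ((\<lambda>x\<in>Obj D. Id E (fobj G x)) (fobj F x))
        (fmor G (fobj F x) (fobj F x) ((\<lambda>x\<in>Obj C. Id D (fobj F x)) x)))
      = (\<lambda>x\<in>Obj C. Id E (fobj (restrict_ftor C (comp_ftor G F)) x))"
      by (rule restrict_ext) (simp add: F.obj G.obj G.pres_id E.id_left E.id_in_hom)
  next
    fix G F G' F' G'' F'' \<beta> \<alpha> \<beta>' \<alpha>'
    assume "G \<in> functors D E" "G' \<in> functors D E" "G'' \<in> functors D E"
      and "F \<in> functors C D" "F' \<in> functors C D" "F'' \<in> functors C D"
      and b: "\<beta> \<in> nat_transfs D E G G'" "\<beta>' \<in> nat_transfs D E G' G''"
      and a: "\<alpha> \<in> nat_transfs C D F F'" "\<alpha>' \<in> nat_transfs C D F' F''"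
    then interpret F: is_functor C D F + F': is_functor C D F' + F'': is_functor C D F''
      + G: is_functor D E G + G': is_functor D E G' + G'': is_functor D E G''
      by (simp_all add: functors_is_functor)
    note o = F.obj F'.obj F''.obj G.obj G'.obj G''.obj
    note A = nat_transfsD(2)[OF a(1)] nat_transfsD(2)[OF a(2)]
    note B = nat_transfsD(2)[OF b(1)] nat_transfsD(2)[OF b(2)]
    show "(\<lambda>x\<in>Obj C. Comp E (fobj G (fobj F x)) (fobj G (fobj F'' x)) (fobj G'' (fobj F'' x))
        ((\<lambda>x\<in>Obj D. Comp E (fobj G x) (fobj G' x) (fobj G'' x) (\<beta>' x) (\<beta> x)) (fobj F'' x))
        (fmor G (fobj F x) (fobj F'' x)
          ((\<lambda>x\<in>Obj C. Comp D (fobj F x) (fobj F' x) (fobj F'' x) (\<alpha>' x) (\<alpha> x)) x)))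
      = (\<lambda>x\<in>Obj C. Comp E (fobj (restrict_ftor C (comp_ftor G F)) x)
          (fobj (restrict_ftor C (comp_ftor G' F')) x) (fobj (restrict_ftor C (comp_ftor G'' F'')) x)
        ((\<lambda>x\<in>Obj C. Comp E (fobj G' (fobj F' x)) (fobj G' (fobj F'' x)) (fobj G'' (fobj F'' x))
          (\<beta>' (fobj F'' x)) (fmor G' (fobj F' x) (fobj F'' x) (\<alpha>' x))) x)
        ((\<lambda>x\<in>Obj C. Comp E (fobj G (fobj F x)) (fobj G (fobj F' x)) (fobj G' (fobj F' x))
          (\<beta> (fobj F' x)) (fmor G (fobj F x) (fobj F' x) (\<alpha> x))) x))"
    proof (rule restrict_ext)
      fix x assume x: "x \<in> Obj C"
      \<comment> \<open>Stated with \<open>G\<close> already distributed over the composite of the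
        two components of \<alpha> and \<alpha>'. The inner exchange is naturality of \<beta> at the
        component of \<alpha>'.\<close>
      have "Comp E (fobj G (fobj F x)) (fobj G (fobj F'' x)) (fobj G'' (fobj F'' x))
          (Comp E (fobj G (fobj F'' x)) (fobj G' (fobj F'' x)) (fobj G'' (fobj F'' x)) (\<beta>' (fobj F'' x)) (\<beta> (fobj F'' x)))
          (Comp E (fobj G (fobj F x)) (fobj G (fobj F' x)) (fobj G (fobj F'' x))
            (fmor G (fobj F' x) (fobj F'' x) (\<alpha>' x)) (fmor G (fobj F x) (fobj F' x) (\<alpha> x)))
        = Comp E (fobj G (fobj F x)) (fobj G' (fobj F' x)) (fobj G'' (fobj F'' x))
          (Comp E (fobj G' (fobj F' x)) (fobj G' (fobj F'' x)) (fobj G'' (fobj F'' x))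
            (\<beta>' (fobj F'' x)) (fmor G' (fobj F' x) (fobj F'' x) (\<alpha>' x)))
          (Comp E (fobj G (fobj F x)) (fobj G (fobj F' x)) (fobj G' (fobj F' x))
            (\<beta> (fobj F' x)) (fmor G (fobj F x) (fobj F' x) (\<alpha> x)))"
        using x by (intro E.middle_four_interchange) (simp_all add: o A B G.mor G'.mor nat_transfsD(3)[OF b(1)])
      then show "Comp E (fobj G (fobj F x)) (fobj G (fobj F'' x)) (fobj G'' (fobj F'' x))
        ((\<lambda>x\<in>Obj D. Comp E (fobj G x) (fobj G' x) (fobj G'' x) (\<beta>' x) (\<beta> x)) (fobj F'' x))
        (fmor G (fobj F x) (fobj F'' x)
          ((\<lambda>x\<in>Obj C. Comp D (fobj F x) (fobj F' x) (fobj F'' x) (\<alpha>' x) (\<alpha> x)) x))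
      = Comp E (fobj (restrict_ftor C (comp_ftor G F)) x)
          (fobj (restrict_ftor C (comp_ftor G' F')) x) (fobj (restrict_ftor C (comp_ftor G'' F'')) x)
        ((\<lambda>x\<in>Obj C. Comp E (fobj G' (fobj F' x)) (fobj G' (fobj F'' x)) (fobj G'' (fobj F'' x))
          (\<beta>' (fobj F'' x)) (fmor G' (fobj F' x) (fobj F'' x) (\<alpha>' x))) x)
        ((\<lambda>x\<in>Obj C. Comp E (fobj G (fobj F x)) (fobj G (fobj F' x)) (fobj G' (fobj F' x))
          (\<beta> (fobj F' x)) (fmor G (fobj F x) (fobj F' x) (\<alpha> x))) x)"
        using x by (simp add: o A B G.pres_comp)
    qed
  }
qed

lemma two_category_CAT: "two_category (CAT el :: (('o, 'v) cat, ('o, 'v, 'o, 'v) ftor, 'o \<Rightarrow> 'v) cat2)"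
proof (rule two_category.intro, unfold CAT_simps functor_cat_simps mem_Collect_eq)
  fix C D :: "('o, 'v) cat" assume "ordinary_category el C" "ordinary_category el D"
  then show "category (functor_cat C D)" by (simp add: category_functor_cat ordinary_category_def)
next
  fix C :: "('o, 'v) cat" assume "ordinary_category el C"
  then show "restrict_ftor C id_ftor \<in> functors C C"
    by (simp add: restrict_ftor_in_functors is_functor_id_ftor ordinary_category_def)
next
  fix C D E :: "('o, 'v) cat"
  assume "ordinary_category el C" "ordinary_category el D" "ordinary_category el E"
  then show "is_functor (prod_cat (functor_cat D E) (functor_cat C D)) (functor_cat C E) (Comp2 (CAT el) C D E)"
    by (simp add: is_functor_CAT_comp ordinary_category_def)
next
  fix C D :: "('o, 'v) cat" and F
  assume "ordinary_category el C" "ordinary_category el D" and F: "F \<in> functors C D"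
  then interpret C: ordinary_category el C + D: ordinary_category el D + F: is_functor C D F
    by (simp_all add: functors_is_functor)
  have r: "restrict_ftor C G \<in> functors C D" if "is_functor C D G" for G
    using C.category_axioms that by (rule restrict_ftor_in_functors)
  show "restrict_ftor C (comp_ftor (restrict_ftor D id_ftor) F) = F"
    by (rule functors_eqI[OF r F])
      (simp_all add: F.obj F.mor is_functor_comp_ftor[OF F.is_functor_axioms]
        is_functor_restrict_ftor[OF D.category_axioms] is_functor_id_ftor)
  show "restrict_ftor C (comp_ftor F (restrict_ftor C id_ftor)) = F"
    by (rule functors_eqI[OF r F])
      (simp_all add: is_functor_comp_ftor[OF _ F.is_functor_axioms]
        is_functor_restrict_ftor[OF C.category_axioms] is_functor_id_ftor)
next
  fix C D :: "('o, 'v) cat" and F F' \<alpha>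
  assume "ordinary_category el C" "ordinary_category el D" "F \<in> functors C D" "F' \<in> functors C D"
    and a: "\<alpha> \<in> nat_transfs C D F F'"
  then interpret C: ordinary_category el C + D: ordinary_category el D
    + F: is_functor C D F + F': is_functor C D F'
    by (simp_all add: functors_is_functor)
  note A = nat_transfsD(2)[OF a]
  show "(\<lambda>x\<in>Obj C. Comp D (fobj (restrict_ftor D id_ftor) (fobj F x))
      (fobj (restrict_ftor D id_ftor) (fobj F' x)) (fobj (restrict_ftor D id_ftor) (fobj F' x))
      ((\<lambda>x\<in>Obj D. Id D (fobj (restrict_ftor D id_ftor) x)) (fobj F' x))
      (fmor (restrict_ftor D id_ftor) (fobj F x) (fobj F' x) (\<alpha> x))) = \<alpha>"
    by (rule extensionalityI[of _ "Obj C"])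
      (simp_all add: nat_transfsD(1)[OF a] A F.obj F'.obj D.id_left)
  show "(\<lambda>x\<in>Obj C. Comp D (fobj F (fobj (restrict_ftor C id_ftor) x))
      (fobj F (fobj (restrict_ftor C id_ftor) x)) (fobj F' (fobj (restrict_ftor C id_ftor) x))
      (\<alpha> (fobj (restrict_ftor C id_ftor) x))
      (fmor F (fobj (restrict_ftor C id_ftor) x) (fobj (restrict_ftor C id_ftor) x)
        ((\<lambda>x\<in>Obj C. Id C (fobj (restrict_ftor C id_ftor) x)) x))) = \<alpha>"
    by (rule extensionalityI[of _ "Obj C"])
      (simp_all add: nat_transfsD(1)[OF a] A F.obj F'.obj F.pres_id D.id_right)
next
  fix C D E E' :: "('o, 'v) cat" and F G H
  assume C: "ordinary_category el C" "ordinary_category el D" "ordinary_category el E" "ordinary_category el E'"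
    and f: "F \<in> functors C D" "G \<in> functors D E" "H \<in> functors E E'"
  then interpret F: is_functor C D F + G: is_functor D E G + H: is_functor E E' H
    by (simp_all add: functors_is_functor)
  \<comment> \<open>The inner restriction to \<open>D\<close> is invisible because \<open>F\<close>
    takes its values in \<open>D\<close>.\<close>
  show "restrict_ftor C (comp_ftor (restrict_ftor D (comp_ftor H G)) F)
      = restrict_ftor C (comp_ftor H (restrict_ftor C (comp_ftor G F)))"
    by (auto simp: restrict_ftor_def fun_eq_iff F.obj F.mor)
  fix F' G' H' \<alpha> \<beta> \<gamma>
  assume f': "F' \<in> functors C D" "G' \<in> functors D E" "H' \<in> functors E E'"
    and a: "\<alpha> \<in> nat_transfs C D F F'" and b: "\<beta> \<in> nat_transfs D E G G'" and c: "\<gamma> \<in> nat_transfs E E' H H'"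
  then interpret F': is_functor C D F' + G': is_functor D E G' + H': is_functor E E' H'
    by (simp_all add: functors_is_functor)
  interpret E': ordinary_category el E' by fact
  \<comment> \<open>On the right \<open>H\<close> acts on a composite in \<open>E\<close>. Once
    \<open>H\<close> is distributed over it, the two sides differ by one use of associativity in
    \<open>E'\<close>.\<close>
  show "(\<lambda>x\<in>Obj C. Comp E' (fobj (restrict_ftor D (comp_ftor H G)) (fobj F x))
      (fobj (restrict_ftor D (comp_ftor H G)) (fobj F' x)) (fobj (restrict_ftor D (comp_ftor H' G')) (fobj F' x))
      ((\<lambda>x\<in>Obj D. Comp E' (fobj H (fobj G x)) (fobj H (fobj G' x)) (fobj H' (fobj G' x))
        (\<gamma> (fobj G' x)) (fmor H (fobj G x) (fobj G' x) (\<beta> x))) (fobj F' x))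
      (fmor (restrict_ftor D (comp_ftor H G)) (fobj F x) (fobj F' x) (\<alpha> x)))
    = (\<lambda>x\<in>Obj C. Comp E' (fobj H (fobj (restrict_ftor C (comp_ftor G F)) x))
      (fobj H (fobj (restrict_ftor C (comp_ftor G' F')) x)) (fobj H' (fobj (restrict_ftor C (comp_ftor G' F')) x))
      (\<gamma> (fobj (restrict_ftor C (comp_ftor G' F')) x))
      (fmor H (fobj (restrict_ftor C (comp_ftor G F)) x) (fobj (restrict_ftor C (comp_ftor G' F')) x)
        ((\<lambda>x\<in>Obj C. Comp E (fobj G (fobj F x)) (fobj G (fobj F' x)) (fobj G' (fobj F' x))
          (\<beta> (fobj F' x)) (fmor G (fobj F x) (fobj F' x) (\<alpha> x))) x)))"
    by (rule restrict_ext)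
      (simp add: F.obj F'.obj G.obj G'.obj H.obj H'.obj G.mor H.mor H.pres_comp E'.assoc
        nat_transfsD(2)[OF a] nat_transfsD(2)[OF b] nat_transfsD(2)[OF c])
qed

section \<open>Slices and full sub-2-categories\<close>

context two_category
begin

lemma comp1_closed:
  "\<lbrakk>a \<in> Obj2 K; b \<in> Obj2 K; c \<in> Obj2 K; f \<in> Obj (Hom2 K a b); g \<in> Obj (Hom2 K b c)\<rbrakk>
    \<Longrightarrow> comp1 K a b c g f \<in> Obj (Hom2 K a c)"
  using is_functor.obj[OF comp_functor, of a b c "(g, f)"] by simp

lemma hcomp_closed:
  "\<lbrakk>a \<in> Obj2 K; b \<in> Obj2 K; c \<in> Obj2 K;
      f \<in> Obj (Hom2 K a b); f' \<in> Obj (Hom2 K a b); \<alpha> \<in> Hom (Hom2 K a b) f f';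
      g \<in> Obj (Hom2 K b c); g' \<in> Obj (Hom2 K b c); \<beta> \<in> Hom (Hom2 K b c) g g'\<rbrakk>
    \<Longrightarrow> hcomp K a b c g g' f f' \<beta> \<alpha> \<in> Hom (Hom2 K a c) (comp1 K a b c g f) (comp1 K a b c g' f')"
  using is_functor.mor[OF comp_functor, of a b c "(g, f)" "(g', f')" "(\<beta>, \<alpha>)"] by simp

lemma hcomp_id:
  "\<lbrakk>a \<in> Obj2 K; b \<in> Obj2 K; c \<in> Obj2 K; f \<in> Obj (Hom2 K a b); g \<in> Obj (Hom2 K b c)\<rbrakk>
    \<Longrightarrow> hcomp K a b c g g f f (Id (Hom2 K b c) g) (Id (Hom2 K a b) f)
      = Id (Hom2 K a c) (comp1 K a b c g f)"
  using is_functor.pres_id[OF comp_functor, of a b c "(g, f)"] by simp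

lemma hcomp_vcomp:
  "\<lbrakk>a \<in> Obj2 K; b \<in> Obj2 K; c \<in> Obj2 K;
      f \<in> Obj (Hom2 K a b); f' \<in> Obj (Hom2 K a b); f'' \<in> Obj (Hom2 K a b);
      \<alpha> \<in> Hom (Hom2 K a b) f f'; \<alpha>' \<in> Hom (Hom2 K a b) f' f'';
      g \<in> Obj (Hom2 K b c); g' \<in> Obj (Hom2 K b c); g'' \<in> Obj (Hom2 K b c);
      \<beta> \<in> Hom (Hom2 K b c) g g'; \<beta>' \<in> Hom (Hom2 K b c) g' g''\<rbrakk>
    \<Longrightarrow> hcomp K a b c g g'' f f'' (Comp (Hom2 K b c) g g' g'' \<beta>' \<beta>) (Comp (Hom2 K a b) f f' f'' \<alpha>' \<alpha>)
      = Comp (Hom2 K a c) (comp1 K a b c g f) (comp1 K a b c g' f') (comp1 K a b c g'' f'')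
          (hcomp K a b c g' g'' f' f'' \<beta>' \<alpha>') (hcomp K a b c g g' f f' \<beta> \<alpha>)"
  using is_functor.pres_comp[OF comp_functor,
    of a b c "(g, f)" "(g', f')" "(g'', f'')" "(\<beta>, \<alpha>)" "(\<beta>', \<alpha>')"]
  by simp

lemma id2_closed: "\<lbrakk>a \<in> Obj2 K; b \<in> Obj2 K; f \<in> Obj (Hom2 K a b)\<rbrakk> \<Longrightarrow> Id (Hom2 K a b) f \<in> Hom (Hom2 K a b) f f"
  by (rule category.id_in_hom[OF hom_category])

text \<open>The identity 2-cell of \<open>g\<close> equals its composite with itself, so this is an
  instance of interchange.\<close>

lemma whisker_vcomp:
  assumes "a \<in> Obj2 K" "b \<in> Obj2 K" "c \<in> Obj2 K"
    and "f \<in> Obj (Hom2 K a b)" "f' \<in> Obj (Hom2 K a b)" "f'' \<in> Obj (Hom2 K a b)"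
    and "\<alpha> \<in> Hom (Hom2 K a b) f f'" "\<alpha>' \<in> Hom (Hom2 K a b) f' f''" "g \<in> Obj (Hom2 K b c)"
  shows "hcomp K a b c g g f f'' (Id (Hom2 K b c) g) (Comp (Hom2 K a b) f f' f'' \<alpha>' \<alpha>)
    = Comp (Hom2 K a c) (comp1 K a b c g f) (comp1 K a b c g f') (comp1 K a b c g f'')
        (hcomp K a b c g g f' f'' (Id (Hom2 K b c) g) \<alpha>') (hcomp K a b c g g f f' (Id (Hom2 K b c) g) \<alpha>)"
proof -
  interpret H: category "Hom2 K b c" using assms by (intro hom_category)
  show ?thesis
    using hcomp_vcomp[OF assms assms(9,9) H.id_in_hom[OF assms(9)] H.id_in_hom[OF assms(9)]] assms(9)
    by (simp add: H.id_left H.id_in_hom)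
qed

end

lemma slice2_simps [simp]:
  "Obj2 (slice2 K b) = {(e, p). e \<in> Obj2 K \<and> p \<in> Obj (Hom2 K e b)}"
  "Obj (Hom2 (slice2 K b) (e, p) (f, q)) = {h \<in> Obj (Hom2 K e f). comp1 K e f b q h = p}"
  "Hom (Hom2 (slice2 K b) (e, p) (f, q)) h k = {\<alpha> \<in> Hom (Hom2 K e f) h k.
    hcomp K e f b q q h k (Id (Hom2 K f b) q) \<alpha> = Id (Hom2 K e b) p}"
  "Id (Hom2 (slice2 K b) (e, p) (f, q)) = Id (Hom2 K e f)"
  "Comp (Hom2 (slice2 K b) (e, p) (f, q)) = Comp (Hom2 K e f)"
  "Id2 (slice2 K b) (e, p) = Id2 K e"
  "Comp2 (slice2 K b) (e, p) (f, q) (g, r) = Comp2 K e f g"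
  by (simp_all add: slice2_def)

text \<open>Cells and operations are those of \<open>K\<close>, so the equations are inherited. What
  needs proof is that each operation keeps the conditions over \<open>b\<close>. For a vertical
  composite the whiskering splits into two identity 2-cells, whose composite is again an
  identity.\<close>

lemma two_category_slice2:
  assumes "two_category K" and b: "b \<in> Obj2 K"
  shows "two_category (slice2 K b)"
proof -
  interpret K: two_category K by fact
  show ?thesis
  proof (rule two_category.intro; clarify?; unfold slice2_simps mem_Collect_eq prod.case; (elim conjE)?)
    fix e p f q assume o: "e \<in> Obj2 K" "p \<in> Obj (Hom2 K e b)" "f \<in> Obj2 K" "q \<in> Obj (Hom2 K f b)"
    interpret H: category "Hom2 K e f" using o by (intro K.hom_category)
    interpret I: category "Hom2 K e b" using o b by (intro K.hom_category)
    show "category (Hom2 (slice2 K b) (e, p) (f, q))"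
    proof (rule category.intro; unfold slice2_simps mem_Collect_eq; (elim conjE)?)
      fix h assume "h \<in> Obj (Hom2 K e f)" "comp1 K e f b q h = p"
      then show "Id (Hom2 K e f) h \<in> Hom (Hom2 K e f) h h \<and>
          hcomp K e f b q q h h (Id (Hom2 K f b) q) (Id (Hom2 K e f) h) = Id (Hom2 K e b) p"
        using o b by (simp add: H.id_in_hom K.hcomp_id)
    next
      fix h k l \<alpha> \<beta>
      assume "h \<in> Obj (Hom2 K e f)" "comp1 K e f b q h = p" "k \<in> Obj (Hom2 K e f)" "comp1 K e f b q k = p"
        "l \<in> Obj (Hom2 K e f)" "comp1 K e f b q l = p"
        "\<alpha> \<in> Hom (Hom2 K e f) h k" "hcomp K e f b q q h k (Id (Hom2 K f b) q) \<alpha> = Id (Hom2 K e b) p"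
        "\<beta> \<in> Hom (Hom2 K e f) k l" "hcomp K e f b q q k l (Id (Hom2 K f b) q) \<beta> = Id (Hom2 K e b) p"
      then show "Comp (Hom2 K e f) h k l \<beta> \<alpha> \<in> Hom (Hom2 K e f) h l \<and>
          hcomp K e f b q q h l (Id (Hom2 K f b) q) (Comp (Hom2 K e f) h k l \<beta> \<alpha>) = Id (Hom2 K e b) p"
        using o b by (simp add: H.comp_in_hom K.whisker_vcomp I.id_left I.id_in_hom)
    qed (simp_all add: H.id_left H.id_right H.assoc)
  next
    fix e p assume "e \<in> Obj2 K" "p \<in> Obj (Hom2 K e b)"
    then show "Id2 K e \<in> Obj (Hom2 K e e) \<and> comp1 K e e b p (Id2 K e) = p"
      using b by (simp add: K.id1 K.right_unit1)
  next
    fix e p f q g r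
    assume o: "e \<in> Obj2 K" "p \<in> Obj (Hom2 K e b)" "f \<in> Obj2 K" "q \<in> Obj (Hom2 K f b)"
      "g \<in> Obj2 K" "r \<in> Obj (Hom2 K g b)"
    note id = K.id2_closed[OF o(5) b o(6)]
    show "is_functor (prod_cat (Hom2 (slice2 K b) (f, q) (g, r)) (Hom2 (slice2 K b) (e, p) (f, q)))
        (Hom2 (slice2 K b) (e, p) (g, r)) (Comp2 K e f g)"
    proof (rule is_functor_prod_catI; unfold slice2_simps mem_Collect_eq; (elim conjE)?)
      fix h k assume "h \<in> Obj (Hom2 K f g)" "comp1 K f g b r h = q" "k \<in> Obj (Hom2 K e f)" "comp1 K e f b q k = p"
      then show "comp1 K e f g h k \<in> Obj (Hom2 K e g) \<and> comp1 K e g b r (comp1 K e f g h k) = p"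
        using o b by (simp add: K.comp1_closed K.assoc1[symmetric])
    next
      \<comment> \<open>By associativity, whiskering the horizontal composite with \<open>r\<close>
        is composing \<alpha> with the whiskering of \<beta> by \<open>r\<close>. The latter is the
        identity of \<open>q\<close>, so the condition on \<alpha> remains.\<close>
      fix h k h' k' \<beta> \<alpha>
      assume "h \<in> Obj (Hom2 K f g)" "comp1 K f g b r h = q" "h' \<in> Obj (Hom2 K f g)" "comp1 K f g b r h' = q"
        "\<beta> \<in> Hom (Hom2 K f g) h h'" "hcomp K f g b r r h h' (Id (Hom2 K g b) r) \<beta> = Id (Hom2 K f b) q"
        "k \<in> Obj (Hom2 K e f)" "comp1 K e f b q k = p" "k' \<in> Obj (Hom2 K e f)" "comp1 K e f b q k' = p"
        "\<alpha> \<in> Hom (Hom2 K e f) k k'" "hcomp K e f b q q k k' (Id (Hom2 K f b) q) \<alpha> = Id (Hom2 K e b) p"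
      then show "hcomp K e f g h h' k k' \<beta> \<alpha> \<in> Hom (Hom2 K e g) (comp1 K e f g h k) (comp1 K e f g h' k') \<and>
          hcomp K e g b r r (comp1 K e f g h k) (comp1 K e f g h' k') (Id (Hom2 K g b) r)
            (hcomp K e f g h h' k k' \<beta> \<alpha>) = Id (Hom2 K e b) p"
        using o b id by (simp add: K.hcomp_closed K.assoc2[symmetric])
    qed (use o in \<open>simp_all add: K.hcomp_id K.hcomp_vcomp\<close>)
  qed (use b in \<open>simp_all add: K.left_unit1 K.right_unit1 K.left_unit2 K.right_unit2 K.assoc1 K.assoc2\<close>)
qed

lemma full_sub2_simps [simp]:
  "Obj2 (full_sub2 K P) = {a \<in> Obj2 K. P a}"
  "Hom2 (full_sub2 K P) = Hom2 K"
  "Id2 (full_sub2 K P) = Id2 K"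
  "Comp2 (full_sub2 K P) = Comp2 K"
  by (simp_all add: full_sub2_def)

lemma two_category_full_sub2:
  assumes "two_category K"
  shows "two_category (full_sub2 K P)"
proof -
  interpret K: two_category K by fact
  show ?thesis
    by (rule two_category.intro)
      (simp_all add: K.hom_category K.id1 K.comp_functor K.left_unit1 K.right_unit1 K.left_unit2
        K.right_unit2 K.assoc1 K.assoc2)
qed

section \<open>Categories enriched in the free quantaloid and faithful functors\<close>

lemma QCAT_simps [simp]:
  "Obj2 (QCAT Q) = {C. q_category Q C}"
  "Obj (Hom2 (QCAT Q) C D) = q_functors Q C D"
  "Hom (Hom2 (QCAT Q) C D) = q_transfs Q C D"
  "Id (Hom2 (QCAT Q) C D) F = ()"
  "Comp (Hom2 (QCAT Q) C D) F G H \<beta> \<alpha> = ()"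
  "Id2 (QCAT Q) C = (\<lambda>x\<in>qobj C. x)"
  "comp1 (QCAT Q) C D E G F = compose (qobj C) G F"
  "fmor (Comp2 (QCAT Q) C D E) GF GF' \<beta>\<alpha> = ()"
  by (simp_all add: QCAT_def)

lemma id_ftor2_simps [simp]: "obj2 id_ftor2 a = a" "hom2 id_ftor2 a b = id_ftor"
  by (simp_all add: id_ftor2_def)

lemma comp_ftor2_simps [simp]:
  "obj2 (comp_ftor2 G F) a = obj2 G (obj2 F a)"
  "hom2 (comp_ftor2 G F) a b = comp_ftor (hom2 G (obj2 F a) (obj2 F b)) (hom2 F a b)"
  by (simp_all add: comp_ftor2_def)

lemma functors_extensional:
  assumes "F \<in> functors C D"
  shows "fobj F \<in> extensional (Obj C)"
proof -
  have "fobj (restrict_ftor C F) \<in> extensional (Obj C)" by (simp add: restrict_ftor_def)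
  then show ?thesis using assms by (simp add: functors_def)
qed

section \<open>The free quantaloid, read through subsets of the hom-sets of \<open>B\<close>\<close>

locale free_quantaloid_base = U: grothendieck_universe el + B: ordinary_category el B
  for el :: "'v \<Rightarrow> 'v set" and B :: "('o, 'v) cat"
begin

abbreviation Q :: "('o, 'v) qtd" where
  "Q \<equiv> free_quantaloid el B"

text \<open>The object type \<open>'o\<close> on this side is the one the other side forces: all
  categories in \<open>CAT el\<close> share one object type, and \<open>B\<close> is among them.
  Both constructions keep the set of objects.\<close>

abbreviation K :: "(('o, 'o, 'v) qcat, 'o \<Rightarrow> 'o, unit) cat2" where
  "K \<equiv> QCAT Q"

abbreviation S :: "(('o, 'v) cat \<times> ('o, 'v, 'o, 'v) ftor, ('o, 'v, 'o, 'v) ftor, 'o \<Rightarrow> 'v) cat2" where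
  "S \<equiv> full_sub2 (slice2 (CAT el) B) (\<lambda>(E, p). faithful E p)"

lemma two_category_K: "two_category K"
  by (intro quantaloid.two_category_QCAT[of el] quantaloid_free_quantaloid
      U.grothendieck_universe_axioms B.ordinary_category_axioms)

lemma two_category_S: "two_category S"
  by (intro two_category_full_sub2 two_category_slice2 two_category_CAT)
    (simp add: B.ordinary_category_axioms)

sublocale S: two_category S
  by (rule two_category_S)

text \<open>\<open>code\<close> inverts \<open>el\<close> only on small sets. A subset of a hom-set
  of \<open>B\<close> is small because \<open>B\<close> has small hom-sets.\<close>

lemma el_code:
  assumes "A \<subseteq> Hom B X Y" "X \<in> Obj B" "Y \<in> Obj B"
  shows "el (code el A) = A"
proof -
  obtain v where "Hom B X Y = el v" using B.small_homs[OF assms(2,3)] by (auto simp: small_def)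
  then have "A \<in> range el" using U.subset[of A v] assms(1) by simp
  then show ?thesis unfolding code_def by (simp add: f_inv_into_f)
qed

lemma code_el [simp]: "code el (el v) = v"
  unfolding code_def using U.extensionality by simp

lemma free_quantaloid_simps [simp]:
  "QObj Q = Obj B"
  "carrier (QHom Q X Y) = {U. el U \<subseteq> Hom B X Y}"
  "u \<sqsubseteq>\<^bsub>QHom Q X Y\<^esub> v \<longleftrightarrow> el u \<subseteq> el v"
  by (simp_all add: free_quantaloid_def)

lemma el_QId [simp]: "X \<in> Obj B \<Longrightarrow> el (QId Q X) = {Id B X}"
  using el_code[of "{Id B X}" X X] by (simp add: free_quantaloid_def B.id_in_hom)

lemma el_QComp:
  assumes "X \<in> Obj B" "Y \<in> Obj B" "Z \<in> Obj B" "el v \<subseteq> Hom B Y Z" "el u \<subseteq> Hom B X Y"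
  shows "el (QComp Q X Y Z v u) = {Comp B X Y Z v' u' | v' u'. v' \<in> el v \<and> u' \<in> el u}"
proof -
  have "{Comp B X Y Z v' u' | v' u'. v' \<in> el v \<and> u' \<in> el u} \<subseteq> Hom B X Z"
    using assms by (auto intro!: B.comp_in_hom)
  from el_code[OF this] assms show ?thesis by (simp add: free_quantaloid_def)
qed

text \<open>Elementwise, the two inequalities of an enriched category become closure under
  identities and composition, which is the form in which they meet the axioms of a category.\<close>

lemma q_categoryI:
  assumes "\<And>x. x \<in> qobj C \<Longrightarrow> extent C x \<in> Obj B"
    and "\<And>x y. \<lbrakk>x \<in> qobj C; y \<in> qobj C\<rbrakk> \<Longrightarrow> el (qhom C x y) \<subseteq> Hom B (extent C x) (extent C y)"
    and "\<And>x. x \<in> qobj C \<Longrightarrow> Id B (extent C x) \<in> el (qhom C x x)"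
    and "\<And>x y z f g. \<lbrakk>x \<in> qobj C; y \<in> qobj C; z \<in> qobj C; f \<in> el (qhom C x y); g \<in> el (qhom C y z)\<rbrakk>
      \<Longrightarrow> Comp B (extent C x) (extent C y) (extent C z) g f \<in> el (qhom C x z)"
  shows "q_category Q C"
  by unfold_locales (use assms in \<open>auto simp: el_QComp\<close>)

lemma q_categoryD:
  assumes "q_category Q C"
  shows "x \<in> qobj C \<Longrightarrow> extent C x \<in> Obj B"
    and "\<lbrakk>x \<in> qobj C; y \<in> qobj C; f \<in> el (qhom C x y)\<rbrakk> \<Longrightarrow> f \<in> Hom B (extent C x) (extent C y)"
    and "x \<in> qobj C \<Longrightarrow> Id B (extent C x) \<in> el (qhom C x x)"
    and "\<lbrakk>x \<in> qobj C; y \<in> qobj C; z \<in> qobj C; f \<in> el (qhom C x y); g \<in> el (qhom C y z)\<rbrakk>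
      \<Longrightarrow> Comp B (extent C x) (extent C y) (extent C z) g f \<in> el (qhom C x z)"
proof -
  interpret C: q_category Q C by fact
  have h: "el (qhom C x y) \<subseteq> Hom B (extent C x) (extent C y)" if "x \<in> qobj C" "y \<in> qobj C" for x y
    using C.hom[OF that] by simp
  have e: "extent C x \<in> Obj B" if "x \<in> qobj C" for x using C.extent[OF that] by simp
  show "x \<in> qobj C \<Longrightarrow> extent C x \<in> Obj B" by (rule e)
  show "\<lbrakk>x \<in> qobj C; y \<in> qobj C; f \<in> el (qhom C x y)\<rbrakk> \<Longrightarrow> f \<in> Hom B (extent C x) (extent C y)"
    using h by blast
  show "x \<in> qobj C \<Longrightarrow> Id B (extent C x) \<in> el (qhom C x x)" using C.unit[of x] e[of x] by simp
  show "\<lbrakk>x \<in> qobj C; y \<in> qobj C; z \<in> qobj C; f \<in> el (qhom C x y); g \<in> el (qhom C y z)\<rbrakk>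
      \<Longrightarrow> Comp B (extent C x) (extent C y) (extent C z) g f \<in> el (qhom C x z)"
    using C.comp[of x y z] by (auto simp: el_QComp e h)
qed

lemma q_functors_free_iff:
  "F \<in> q_functors Q C D \<longleftrightarrow> F \<in> qobj C \<rightarrow>\<^sub>E qobj D \<and> (\<forall>x\<in>qobj C. extent D (F x) = extent C x) \<and>
    (\<forall>x\<in>qobj C. \<forall>y\<in>qobj C. el (qhom C x y) \<subseteq> el (qhom D (F x) (F y)))"
  by (simp add: q_functors_def)

lemma q_functors_freeD:
  assumes "F \<in> q_functors Q C D"
  shows "x \<in> qobj C \<Longrightarrow> F x \<in> qobj D"
    and "x \<in> qobj C \<Longrightarrow> extent D (F x) = extent C x"
    and "\<lbrakk>x \<in> qobj C; y \<in> qobj C; f \<in> el (qhom C x y)\<rbrakk> \<Longrightarrow> f \<in> el (qhom D (F x) (F y))"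
    and "F \<in> extensional (qobj C)"
  using assms unfolding q_functors_free_iff by (auto simp: PiE_iff) blast

text \<open>An identity of the free quantaloid is a singleton, so being below a hom-object is
  membership of its one element.\<close>

lemma q_transfs_free_iff:
  assumes "q_category Q C"
  shows "u \<in> q_transfs Q C D F G \<longleftrightarrow> (\<forall>x\<in>qobj C. Id B (extent C x) \<in> el (qhom D (F x) (G x)))"
  by (simp add: q_transfs_iff q_categoryD(1)[OF assms])

section \<open>1-cells and 2-cells of the slice over \<open>B\<close> between faithful
  functors\<close>

lemma slice_objD:
  assumes "(E, p) \<in> Obj2 S"
  shows "ordinary_category el E" "category E" "p \<in> functors E B" "is_functor E B p"
    and "\<lbrakk>x \<in> Obj E; y \<in> Obj E\<rbrakk> \<Longrightarrow> inj_on (fmor p x y) (Hom E x y)"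
  using assms by (simp_all add: faithful_def ordinary_category_def functors_is_functor)

lemma slice_1cellI:
  assumes "(E, p) \<in> Obj2 S" "h \<in> functors E E'"
    and "\<And>x. x \<in> Obj E \<Longrightarrow> fobj p' (fobj h x) = fobj p x"
    and "\<And>x y f. \<lbrakk>x \<in> Obj E; y \<in> Obj E; f \<in> Hom E x y\<rbrakk>
      \<Longrightarrow> fmor p' (fobj h x) (fobj h y) (fmor h x y f) = fmor p x y f"
  shows "h \<in> Obj (Hom2 S (E, p) (E', p'))"
proof -
  have "restrict_ftor E (comp_ftor p' h) = restrict_ftor E p"
    by (rule restrict_ftor_cong) (simp_all add: assms(3,4))
  then show ?thesis using assms(2) slice_objD(3)[OF assms(1)] by (simp add: functors_def)
qed

lemma slice_1cellD:
  assumes "h \<in> Obj (Hom2 S (E, p) (E', p'))"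
  shows "h \<in> functors E E'" "is_functor E E' h"
    and "x \<in> Obj E \<Longrightarrow> fobj p' (fobj h x) = fobj p x"
    and "\<lbrakk>x \<in> Obj E; y \<in> Obj E; f \<in> Hom E x y\<rbrakk>
      \<Longrightarrow> fmor p' (fobj h x) (fobj h y) (fmor h x y f) = fmor p x y f"
  using assms by (auto simp: functors_is_functor)

text \<open>Faithfulness of the codomain makes the slice locally a preorder, with 1-cells determined
  by their action on objects.\<close>

lemma slice_1cell_eqI:
  assumes a: "a \<in> Obj2 S" and b: "b \<in> Obj2 S"
    and h: "h \<in> Obj (Hom2 S a b)" and k: "k \<in> Obj (Hom2 S a b)"
    and eq: "\<And>x. x \<in> Obj (fst a) \<Longrightarrow> fobj h x = fobj k x"
  shows "h = k"
proof -
  obtain E p E' p' where ab: "a = (E, p)" "b = (E', p')" by (cases a, cases b)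
  note a = a[unfolded ab] and b = b[unfolded ab] and h = h[unfolded ab] and k = k[unfolded ab]
  interpret h: is_functor E E' h using h by (rule slice_1cellD)
  interpret k: is_functor E E' k using k by (rule slice_1cellD)
  show ?thesis
  proof (rule functors_eqI[OF slice_1cellD(1)[OF h] slice_1cellD(1)[OF k]])
    fix x y f assume x: "x \<in> Obj E" "y \<in> Obj E" "f \<in> Hom E x y"
    have e: "fobj k x = fobj h x" "fobj k y = fobj h y" using eq x by (simp_all add: ab)
    show "fmor h x y f = fmor k x y f"
    proof (rule inj_onD[OF slice_objD(5)[OF b h.obj[OF x(1)] h.obj[OF x(2)]]])
      show "fmor p' (fobj h x) (fobj h y) (fmor h x y f) = fmor p' (fobj h x) (fobj h y) (fmor k x y f)"
        using slice_1cellD(4)[OF h x] slice_1cellD(4)[OF k x] by (simp add: e)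
      show "fmor h x y f \<in> Hom E' (fobj h x) (fobj h y)" using x by (rule h.mor)
      show "fmor k x y f \<in> Hom E' (fobj h x) (fobj h y)" using k.mor[OF x] by (simp add: e)
    qed
  qed (simp add: eq ab)
qed

text \<open>At \<open>x\<close> the whiskering with \<open>p'\<close> is an identity composed with
  the image of \<open>\<alpha> x\<close> under \<open>p'\<close>, so the slice condition says that
  every component lies over an identity.\<close>

lemma slice_2cellD:
  assumes a: "(E, p) \<in> Obj2 S" and b: "(E', p') \<in> Obj2 S"
    and h: "h \<in> Obj (Hom2 S (E, p) (E', p'))" and k: "k \<in> Obj (Hom2 S (E, p) (E', p'))"
    and \<alpha>: "\<alpha> \<in> Hom (Hom2 S (E, p) (E', p')) h k"
  shows "\<alpha> \<in> extensional (Obj E)"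
    and "x \<in> Obj E \<Longrightarrow> \<alpha> x \<in> Hom E' (fobj h x) (fobj k x)"
    and "x \<in> Obj E \<Longrightarrow> fmor p' (fobj h x) (fobj k x) (\<alpha> x) = Id B (fobj p x)"
proof -
  have n: "\<alpha> \<in> nat_transfs E E' h k" using \<alpha> by simp
  show "\<alpha> \<in> extensional (Obj E)" using nat_transfsD(1)[OF n] .
  show c: "\<alpha> x \<in> Hom E' (fobj h x) (fobj k x)" if "x \<in> Obj E" for x using nat_transfsD(2)[OF n that] .
  interpret p': is_functor E' B p' using b by (rule slice_objD)
  interpret h: is_functor E E' h using h by (rule slice_1cellD)
  interpret k: is_functor E E' k using k by (rule slice_1cellD)
  assume x: "x \<in> Obj E"
  have "(\<lambda>x\<in>Obj E. Comp B (fobj p' (fobj h x)) (fobj p' (fobj k x)) (fobj p' (fobj k x))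
      ((\<lambda>y\<in>Obj E'. Id B (fobj p' y)) (fobj k x)) (fmor p' (fobj h x) (fobj k x) (\<alpha> x)))
    = (\<lambda>x\<in>Obj E. Id B (fobj p x))"
    using \<alpha> by simp
  from fun_cong[OF this, of x] x show "fmor p' (fobj h x) (fobj k x) (\<alpha> x) = Id B (fobj p x)"
    by (simp add: B.id_left[OF p'.obj p'.obj p'.mor] h.obj k.obj c)
qed

text \<open>Naturality follows from faithfulness: the components lie over identities, so
  \<open>p'\<close> sends both legs of a naturality square to \<open>p f\<close>, and
  \<open>p'\<close> is injective on the hom-set that contains both legs.\<close>

lemma slice_2cellI:
  assumes a: "(E, p) \<in> Obj2 S" and b: "(E', p') \<in> Obj2 S"
    and h: "h \<in> Obj (Hom2 S (E, p) (E', p'))" and k: "k \<in> Obj (Hom2 S (E, p) (E', p'))"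
    and e: "\<alpha> \<in> extensional (Obj E)"
    and c: "\<And>x. x \<in> Obj E \<Longrightarrow> \<alpha> x \<in> Hom E' (fobj h x) (fobj k x)"
    and i: "\<And>x. x \<in> Obj E \<Longrightarrow> fmor p' (fobj h x) (fobj k x) (\<alpha> x) = Id B (fobj p x)"
  shows "\<alpha> \<in> Hom (Hom2 S (E, p) (E', p')) h k"
proof -
  interpret E': category E' using b by (rule slice_objD)
  interpret p: is_functor E B p using a by (rule slice_objD)
  interpret p': is_functor E' B p' using b by (rule slice_objD)
  interpret h: is_functor E E' h using h by (rule slice_1cellD)
  interpret k: is_functor E E' k using k by (rule slice_1cellD)
  note H = slice_1cellD(3,4)[OF h] and K = slice_1cellD(3,4)[OF k]
  have "\<alpha> \<in> nat_transfs E E' h k"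
  proof (rule nat_transfsI)
    fix x y f assume x: "x \<in> Obj E" "y \<in> Obj E" "f \<in> Hom E x y"
    show "Comp E' (fobj h x) (fobj h y) (fobj k y) (\<alpha> y) (fmor h x y f)
      = Comp E' (fobj h x) (fobj k x) (fobj k y) (fmor k x y f) (\<alpha> x)"
    proof (rule inj_onD[OF slice_objD(5)[OF b h.obj[OF x(1)] k.obj[OF x(2)]]])
      show "fmor p' (fobj h x) (fobj k y) (Comp E' (fobj h x) (fobj h y) (fobj k y) (\<alpha> y) (fmor h x y f))
        = fmor p' (fobj h x) (fobj k y) (Comp E' (fobj h x) (fobj k x) (fobj k y) (fmor k x y f) (\<alpha> x))"
        using x by (simp add: p'.pres_comp h.obj k.obj h.mor k.mor c i H K
            B.id_left[OF p.obj p.obj p.mor] B.id_right[OF p.obj p.obj p.mor])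
    qed (use x in \<open>simp_all add: E'.comp_in_hom h.obj k.obj h.mor k.mor c\<close>)
  qed (simp_all add: e c)
  moreover have "(\<lambda>x\<in>Obj E. Comp B (fobj p' (fobj h x)) (fobj p' (fobj k x)) (fobj p' (fobj k x))
      ((\<lambda>y\<in>Obj E'. Id B (fobj p' y)) (fobj k x)) (fmor p' (fobj h x) (fobj k x) (\<alpha> x)))
    = (\<lambda>x\<in>Obj E. Id B (fobj p x))"
    by (rule restrict_ext) (simp add: h.obj k.obj i H K p.obj B.id_left B.id_in_hom)
  ultimately show ?thesis by simp
qed

text \<open>With this, every equation between 2-cells of \<open>S\<close> reduces to checking that
  its two sides have the same source and target.\<close>

lemma slice_2cell_unique:
  assumes a: "a \<in> Obj2 S" and b: "b \<in> Obj2 S"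
    and h: "h \<in> Obj (Hom2 S a b)" and k: "k \<in> Obj (Hom2 S a b)"
    and \<alpha>: "\<alpha> \<in> Hom (Hom2 S a b) h k" and \<beta>: "\<beta> \<in> Hom (Hom2 S a b) h k"
  shows "\<alpha> = \<beta>"
proof -
  obtain E p E' p' where ab: "a = (E, p)" "b = (E', p')" by (cases a, cases b)
  note l = a[unfolded ab] b[unfolded ab] h[unfolded ab] k[unfolded ab]
  note A = slice_2cellD[OF l \<alpha>[unfolded ab]] and B = slice_2cellD[OF l \<beta>[unfolded ab]]
  interpret h: is_functor E E' h using l(3) by (rule slice_1cellD)
  interpret k: is_functor E E' k using l(4) by (rule slice_1cellD)
  show ?thesis
  proof (rule extensionalityI[OF A(1) B(1)])
    fix x assume x: "x \<in> Obj E"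
    show "\<alpha> x = \<beta> x"
      by (rule inj_onD[OF slice_objD(5)[OF l(2) h.obj[OF x] k.obj[OF x]]]) (simp_all add: A B x)
  qed
qed

section \<open>Data of the two 2-functors\<close>

definition total_cat :: "('x, 'o, 'v) qcat \<Rightarrow> ('x, 'v) cat" where
  "total_cat C = \<lparr>Obj = qobj C, Hom = (\<lambda>x y. el (qhom C x y)), Id = (\<lambda>x. Id B (extent C x)),
    Comp = (\<lambda>x y z. Comp B (extent C x) (extent C y) (extent C z))\<rparr>"

text \<open>Hom-sets may overlap, so the elements of a hom-object serve as morphisms without tags,
  and the projection can be literally the identity on them.\<close>

definition total_proj :: "('x, 'o, 'v) qcat \<Rightarrow> ('x, 'v, 'o, 'v) ftor" where
  "total_proj C = restrict_ftor (total_cat C) \<lparr>fobj = extent C, fmor = (\<lambda>x y f. f)\<rparr>"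

definition total_ftor :: "('x, 'o, 'v) qcat \<Rightarrow> ('x \<Rightarrow> 'y) \<Rightarrow> ('x, 'v, 'y, 'v) ftor" where
  "total_ftor C F = restrict_ftor (total_cat C) \<lparr>fobj = F, fmor = (\<lambda>x y f. f)\<rparr>"

text \<open>The components on 2-cells are forced: each must lie over an identity of
  \<open>B\<close>, and the projection fixes morphisms.\<close>

definition total2 ::
  "(('o, 'o, 'v) qcat, 'o \<Rightarrow> 'o, unit, ('o, 'v) cat \<times> ('o, 'v, 'o, 'v) ftor,
    ('o, 'v, 'o, 'v) ftor, 'o \<Rightarrow> 'v) ftor2" where
  "total2 = \<lparr>obj2 = (\<lambda>C. (total_cat C, total_proj C)),
    hom2 = (\<lambda>C D. \<lparr>fobj = total_ftor C, fmor = (\<lambda>F G u. \<lambda>x\<in>qobj C. Id B (extent C x))\<rparr>)\<rparr>"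

text \<open>The hom-object from \<open>x\<close> to \<open>y\<close> consists of the morphisms of
  \<open>B\<close> that lift to a morphism of \<open>E\<close> between these two objects. Being a
  subset of a hom-set of \<open>B\<close>, it has a code.\<close>

definition fibre_qcat :: "('x, 'v) cat \<times> ('x, 'v, 'o, 'v) ftor \<Rightarrow> ('x, 'o, 'v) qcat" where
  "fibre_qcat = (\<lambda>(E, p). \<lparr>qobj = Obj E, extent = fobj p,
    qhom = (\<lambda>x y. code el (fmor p x y ` Hom E x y))\<rparr>)"

definition fibre2 ::
  "(('o, 'v) cat \<times> ('o, 'v, 'o, 'v) ftor, ('o, 'v, 'o, 'v) ftor, 'o \<Rightarrow> 'v,
    ('o, 'o, 'v) qcat, 'o \<Rightarrow> 'o, unit) ftor2" where
  "fibre2 = \<lparr>obj2 = fibre_qcat, hom2 = (\<lambda>a b. \<lparr>fobj = fobj, fmor = (\<lambda>h k \<alpha>. ())\<rparr>)\<rparr>"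

lemma total_cat_simps [simp]:
  "Obj (total_cat C) = qobj C"
  "Hom (total_cat C) x y = el (qhom C x y)"
  "Id (total_cat C) x = Id B (extent C x)"
  "Comp (total_cat C) x y z = Comp B (extent C x) (extent C y) (extent C z)"
  by (simp_all add: total_cat_def)

lemma total_proj_simps [simp]:
  "x \<in> qobj C \<Longrightarrow> fobj (total_proj C) x = extent C x"
  "\<lbrakk>x \<in> qobj C; y \<in> qobj C; f \<in> el (qhom C x y)\<rbrakk> \<Longrightarrow> fmor (total_proj C) x y f = f"
  by (simp_all add: total_proj_def)

lemma total_ftor_simps [simp]:
  "x \<in> qobj C \<Longrightarrow> fobj (total_ftor C F) x = F x"
  "\<lbrakk>x \<in> qobj C; y \<in> qobj C; f \<in> el (qhom C x y)\<rbrakk> \<Longrightarrow> fmor (total_ftor C F) x y f = f"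
  by (simp_all add: total_ftor_def)

lemma total2_simps [simp]:
  "obj2 total2 C = (total_cat C, total_proj C)"
  "fobj (hom2 total2 C D) = total_ftor C"
  "fmor (hom2 total2 C D) F G u = (\<lambda>x\<in>qobj C. Id B (extent C x))"
  by (simp_all add: total2_def)

lemma fibre_qcat_simps [simp]:
  "qobj (fibre_qcat (E, p)) = Obj E"
  "extent (fibre_qcat (E, p)) = fobj p"
  "qhom (fibre_qcat (E, p)) x y = code el (fmor p x y ` Hom E x y)"
  by (simp_all add: fibre_qcat_def)

lemma fibre2_simps [simp]:
  "obj2 fibre2 a = fibre_qcat a"
  "fobj (hom2 fibre2 a b) = fobj"
  "fmor (hom2 fibre2 a b) h k \<alpha> = ()"
  by (simp_all add: fibre2_def)

section \<open>The 2-functor from enriched categories to faithful functors\<close>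

lemma category_total_cat:
  assumes "q_category Q C"
  shows "category (total_cat C)"
proof -
  note C = q_categoryD[OF assms]
  show ?thesis
    by unfold_locales (simp_all add: C B.id_left[OF C(1) C(1) C(2)] B.id_right[OF C(1) C(1) C(2)]
        B.assoc[OF C(1) C(1) C(1) C(1) C(2) C(2) C(2)])
qed

lemma total_obj:
  assumes "q_category Q C"
  shows "(total_cat C, total_proj C) \<in> Obj2 S"
proof -
  note C = q_categoryD[OF assms]
  have "is_functor (total_cat C) B \<lparr>fobj = extent C, fmor = (\<lambda>x y f. f)\<rparr>"
    by unfold_locales (simp_all add: C)
  then have "total_proj C \<in> functors (total_cat C) B"
    unfolding total_proj_def by (rule restrict_ftor_in_functors[OF category_total_cat[OF assms]])
  moreover have "ordinary_category el (total_cat C)"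
    by (intro ordinary_category.intro ordinary_category_axioms.intro category_total_cat assms)
      (simp add: small_def)
  moreover have "faithful (total_cat C) (total_proj C)"
    by (auto simp: faithful_def intro!: inj_onI)
  ultimately show ?thesis by simp
qed

text \<open>The inequality of hom-objects required of \<open>F\<close> says that a morphism of the
  domain, sent to itself, is a morphism of the codomain.\<close>

lemma total_1cell:
  assumes C: "q_category Q C" and D: "q_category Q D" and F: "F \<in> q_functors Q C D"
  shows "total_ftor C F \<in> Obj (Hom2 S (total_cat C, total_proj C) (total_cat D, total_proj D))"
proof (rule slice_1cellI[OF total_obj[OF C]])
  note F' = q_functors_freeD[OF F]
  have "is_functor (total_cat C) (total_cat D) \<lparr>fobj = F, fmor = (\<lambda>x y f. f)\<rparr>"
    by unfold_locales (simp_all add: F')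
  then show "total_ftor C F \<in> functors (total_cat C) (total_cat D)"
    unfolding total_ftor_def by (rule restrict_ftor_in_functors[OF category_total_cat[OF C]])
qed (simp_all add: q_functors_freeD[OF F])

text \<open>Only the existence of \<open>u\<close> counts: it puts the identity of the extent of
  \<open>x\<close> into the hom-object from \<open>F x\<close> to \<open>G x\<close>, where the
  component is needed.\<close>

lemma total_2cell:
  assumes C: "q_category Q C" and D: "q_category Q D"
    and F: "F \<in> q_functors Q C D" and G: "G \<in> q_functors Q C D" and u: "u \<in> q_transfs Q C D F G"
  shows "(\<lambda>x\<in>qobj C. Id B (extent C x))
    \<in> Hom (Hom2 S (total_cat C, total_proj C) (total_cat D, total_proj D)) (total_ftor C F) (total_ftor C G)"
  by (rule slice_2cellI[OF total_obj[OF C] total_obj[OF D] total_1cell[OF C D F] total_1cell[OF C D G]])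
    (use u in \<open>simp_all add: q_transfs_free_iff[OF C] q_functors_freeD[OF F] q_functors_freeD[OF G]\<close>)

lemma two_functor_total2: "two_functor K S total2"
proof -
  interpret K: two_category K by (rule two_category_K)
  have id: "total_ftor C (\<lambda>x\<in>qobj C. x) = restrict_ftor (total_cat C) id_ftor" for C :: "('o, 'o, 'v) qcat"
    unfolding total_ftor_def by (rule restrict_ftor_cong) simp_all
  have comp: "total_ftor C (compose (qobj C) G F) = restrict_ftor (total_cat C) (comp_ftor (total_ftor D G) (total_ftor C F))"
    if "F \<in> q_functors Q C D" for C D :: "('o, 'o, 'v) qcat" and F G :: "'o \<Rightarrow> 'o"
    unfolding total_ftor_def[of C "compose (qobj C) G F"]
    by (rule restrict_ftor_cong) (simp_all add: compose_def q_functors_freeD[OF that])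
  show ?thesis
  proof (rule two_functor.intro; unfold total2_simps QCAT_simps mem_Collect_eq)
    fix C D :: "('o, 'o, 'v) qcat" assume C: "q_category Q C" and D: "q_category Q D"
    note o = total_obj[OF C] total_obj[OF D]
    interpret H: category "Hom2 S (total_cat C, total_proj C) (total_cat D, total_proj D)"
      by (rule S.hom_category[OF o])
    show "is_functor (Hom2 K C D) (Hom2 S (total_cat C, total_proj C) (total_cat D, total_proj D)) (hom2 total2 C D)"
    proof (rule is_functor.intro; unfold total2_simps QCAT_simps)
      fix F assume F: "F \<in> q_functors Q C D"
      show c: "total_ftor C F \<in> Obj (Hom2 S (total_cat C, total_proj C) (total_cat D, total_proj D))"
        by (rule total_1cell[OF C D F])
      \<comment> \<open>\<open>total_2cell\<close> asks for a transformation to exist. That the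
        identity one does is read off from the 2-category structure of \<open>K\<close>.\<close>
      have i: "() \<in> q_transfs Q C D F F" using K.id2_closed[of C D F] C D F by simp
      show "(\<lambda>x\<in>qobj C. Id B (extent C x))
        = Id (Hom2 S (total_cat C, total_proj C) (total_cat D, total_proj D)) (total_ftor C F)"
        by (rule slice_2cell_unique[OF o c c total_2cell[OF C D F F i] H.id_in_hom[OF c]])
    next
      fix F G u assume F: "F \<in> q_functors Q C D" "G \<in> q_functors Q C D" "u \<in> q_transfs Q C D F G"
      show "(\<lambda>x\<in>qobj C. Id B (extent C x))
        \<in> Hom (Hom2 S (total_cat C, total_proj C) (total_cat D, total_proj D)) (total_ftor C F) (total_ftor C G)"
        by (rule total_2cell[OF C D F])
    next
      fix F G H u v assume F: "F \<in> q_functors Q C D" "G \<in> q_functors Q C D" "H \<in> q_functors Q C D"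
        and u: "u \<in> q_transfs Q C D F G" and v: "v \<in> q_transfs Q C D G H"
      let ?I = "\<lambda>x\<in>qobj C. Id B (extent C x)"
      note c = F[THEN total_1cell[OF C D]]
      note K = category.comp_in_hom[OF K.hom_category, of C D F G H u v]
      have w: "() \<in> q_transfs Q C D F H" using K C D F u v by simp
      show "?I = Comp (Hom2 S (total_cat C, total_proj C) (total_cat D, total_proj D))
          (total_ftor C F) (total_ftor C G) (total_ftor C H) ?I ?I"
        by (rule slice_2cell_unique[OF o c(1,3) total_2cell[OF C D F(1,3) w]
              H.comp_in_hom[OF c total_2cell[OF C D F(1,2) u] total_2cell[OF C D F(2,3) v]]])
    qed
  next
    fix C D E :: "('o, 'o, 'v) qcat" and F F' u G G' v
    assume C: "q_category Q C" and D: "q_category Q D" and E: "q_category Q E"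
      and F: "F \<in> q_functors Q C D" and F': "F' \<in> q_functors Q C D" and u: "u \<in> q_transfs Q C D F F'"
      and G: "G \<in> q_functors Q D E" and G': "G' \<in> q_functors Q D E" and v: "v \<in> q_transfs Q D E G G'"
    let ?C = "(total_cat C, total_proj C)" and ?D = "(total_cat D, total_proj D)" and ?E = "(total_cat E, total_proj E)"
    have GF: "compose (qobj C) G F \<in> q_functors Q C E" "compose (qobj C) G' F' \<in> q_functors Q C E"
      "() \<in> q_transfs Q C E (compose (qobj C) G F) (compose (qobj C) G' F')"
      using K.comp1_closed[of C D E F G] K.comp1_closed[of C D E F' G'] K.hcomp_closed[of C D E F F' u G G' v]
        C D E F F' u G G' v by simp_all
    \<comment> \<open>This types the horizontal composite between composites of total functors. By
      \<open>comp\<close> these are the total functors of the composites, so uniqueness of 2-cells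
      applies.\<close>
    note h = S.hcomp_closed[OF total_obj[OF C] total_obj[OF D] total_obj[OF E] total_1cell[OF C D F]
        total_1cell[OF C D F'] total_2cell[OF C D F F' u] total_1cell[OF D E G] total_1cell[OF D E G'] total_2cell[OF D E G G' v]]
    show "(\<lambda>x\<in>qobj C. Id B (extent C x)) = hcomp S ?C ?D ?E (total_ftor D G) (total_ftor D G')
        (total_ftor C F) (total_ftor C F') (\<lambda>x\<in>qobj D. Id B (extent D x)) (\<lambda>x\<in>qobj C. Id B (extent C x))"
      by (rule slice_2cell_unique[OF total_obj[OF C] total_obj[OF E] total_1cell[OF C E GF(1)]
            total_1cell[OF C E GF(2)] total_2cell[OF C E GF]])
        (use h in \<open>simp only: comp[OF F] comp[OF F'] full_sub2_simps slice2_simps CAT_simps\<close>)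
  qed (use total_obj in \<open>simp_all add: id comp\<close>)
qed

section \<open>The 2-functor from faithful functors to enriched categories\<close>

lemma fibre_hom:
  assumes "(E, p) \<in> Obj2 S" "x \<in> Obj E" "y \<in> Obj E"
  shows "el (code el (fmor p x y ` Hom E x y)) = fmor p x y ` Hom E x y"
proof (rule el_code)
  interpret p: is_functor E B p using assms(1) by (rule slice_objD)
  show "fmor p x y ` Hom E x y \<subseteq> Hom B (fobj p x) (fobj p y)" using p.mor assms by blast
  show "fobj p x \<in> Obj B" "fobj p y \<in> Obj B" using p.obj assms by auto
qed

lemma fibre_obj:
  assumes "(E, p) \<in> Obj2 S"
  shows "q_category Q (fibre_qcat (E, p))"
proof -
  interpret E: category E using assms by (rule slice_objD)
  interpret p: is_functor E B p using assms by (rule slice_objD)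
  show ?thesis
  proof (rule q_categoryI; simp only: fibre_qcat_simps fibre_hom[OF assms])
    show "Id B (fobj p x) \<in> fmor p x x ` Hom E x x" if "x \<in> Obj E" for x
      using that E.id_in_hom by (force simp: p.pres_id[symmetric])
    show "Comp B (fobj p x) (fobj p y) (fobj p z) g f \<in> fmor p x z ` Hom E x z"
      if x: "x \<in> Obj E" "y \<in> Obj E" "z \<in> Obj E" and im: "f \<in> fmor p x y ` Hom E x y" "g \<in> fmor p y z ` Hom E y z"
      for x y z f g
    proof -
      \<comment> \<open>The two lifts share the object \<open>y\<close> of \<open>E\<close>, not
        merely its image in \<open>B\<close>, so they compose in \<open>E\<close>.\<close>
      obtain f' g' where fg: "f' \<in> Hom E x y" "g' \<in> Hom E y z" "f = fmor p x y f'" "g = fmor p y z g'"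
        using im by blast
      then have "Comp B (fobj p x) (fobj p y) (fobj p z) g f = fmor p x z (Comp E x y z g' f')"
        using x by (simp add: p.pres_comp)
      then show ?thesis using E.comp_in_hom[OF x fg(1,2)] by blast
    qed
  qed (auto simp: p.obj p.mor)
qed

text \<open>Since \<open>h\<close> commutes with the functors to \<open>B\<close>, the image of
  \<open>f\<close> under \<open>p\<close> is the image of \<open>h f\<close> under
  \<open>p'\<close>, hence an element of the second hom-object.\<close>

lemma fibre_1cell:
  assumes a: "(E, p) \<in> Obj2 S" and b: "(E', p') \<in> Obj2 S" and h: "h \<in> Obj (Hom2 S (E, p) (E', p'))"
  shows "fobj h \<in> q_functors Q (fibre_qcat (E, p)) (fibre_qcat (E', p'))"
proof -
  interpret h: is_functor E E' h using h by (rule slice_1cellD)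
  have "fmor p x y ` Hom E x y \<subseteq> fmor p' (fobj h x) (fobj h y) ` Hom E' (fobj h x) (fobj h y)"
    if "x \<in> Obj E" "y \<in> Obj E" for x y
    using h.mor[OF that] by (auto simp: slice_1cellD(4)[OF h that, symmetric])
  then show ?thesis
    by (simp add: q_functors_free_iff fibre_hom[OF a] fibre_hom[OF b] h.obj slice_1cellD(3)[OF h] PiE_iff
        functors_extensional[OF slice_1cellD(1)[OF h]])
qed

text \<open>The component of \<alpha> at \<open>x\<close> is a lift of the identity of
  \<open>p x\<close>, which is what membership in the image asks for.\<close>

lemma fibre_2cell:
  assumes a: "(E, p) \<in> Obj2 S" and b: "(E', p') \<in> Obj2 S"
    and h: "h \<in> Obj (Hom2 S (E, p) (E', p'))" and k: "k \<in> Obj (Hom2 S (E, p) (E', p'))"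
    and \<alpha>: "\<alpha> \<in> Hom (Hom2 S (E, p) (E', p')) h k"
  shows "() \<in> q_transfs Q (fibre_qcat (E, p)) (fibre_qcat (E', p')) (fobj h) (fobj k)"
  unfolding q_transfs_free_iff[OF fibre_obj[OF a]] fibre_qcat_simps
proof
  interpret h: is_functor E E' h using h by (rule slice_1cellD)
  interpret k: is_functor E E' k using k by (rule slice_1cellD)
  fix x assume x: "x \<in> Obj E"
  show "Id B (fobj p x) \<in> el (code el (fmor p' (fobj h x) (fobj k x) ` Hom E' (fobj h x) (fobj k x)))"
    unfolding fibre_hom[OF b h.obj[OF x] k.obj[OF x]]
    using slice_2cellD(2,3)[OF a b h k \<alpha> x] by (metis imageI)
qed

lemma two_functor_fibre2: "two_functor S K fibre2"
proof (rule two_functor.intro; unfold fibre2_simps QCAT_simps mem_Collect_eq)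
  show "q_category Q (fibre_qcat a)" if "a \<in> Obj2 S" for a
    using that fibre_obj by (cases a) blast
  show "is_functor (Hom2 S a b) (Hom2 K (fibre_qcat a) (fibre_qcat b)) (hom2 fibre2 a b)"
    if "a \<in> Obj2 S" "b \<in> Obj2 S" for a b
  proof (rule is_functor.intro; unfold fibre2_simps QCAT_simps)
    show "fobj h \<in> q_functors Q (fibre_qcat a) (fibre_qcat b)" if "h \<in> Obj (Hom2 S a b)" for h
      using that \<open>a \<in> Obj2 S\<close> \<open>b \<in> Obj2 S\<close> by (cases a; cases b) (simp only: fibre_1cell)
    show "() \<in> q_transfs Q (fibre_qcat a) (fibre_qcat b) (fobj h) (fobj k)"
      if "h \<in> Obj (Hom2 S a b)" "k \<in> Obj (Hom2 S a b)" "\<alpha> \<in> Hom (Hom2 S a b) h k" for h k \<alpha>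
      using that \<open>a \<in> Obj2 S\<close> \<open>b \<in> Obj2 S\<close> by (cases a; cases b) (simp only: fibre_2cell)
  qed simp_all
  show "fobj (Id2 S a) = (\<lambda>x\<in>qobj (fibre_qcat a). x)" if "a \<in> Obj2 S" for a
    by (cases a) (auto simp: restrict_ftor_def)
  show "fobj (comp1 S a b c g f) = compose (qobj (fibre_qcat a)) (fobj g) (fobj f)" for a b c g f
    by (cases a; cases b; cases c) (auto simp: restrict_ftor_def compose_def)
qed simp

section \<open>The unit, an isomorphism at every enriched category\<close>

lemma fibre_total_iso:
  "two_natural_isomorphism K K id_ftor2 (comp_ftor2 fibre2 total2) (\<lambda>C. \<lambda>x\<in>qobj C. x)"
proof -
  \<comment> \<open>The projection fixes morphisms between objects of \<open>C\<close>; elsewhere it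
    is \<open>undefined\<close>, so the hom-objects are compared only at objects of
    \<open>C\<close>.\<close>
  have eq: "el (code el (fmor (total_proj C) x y ` el (qhom C x y))) = el (qhom C x y)"
    if "x \<in> qobj C" "y \<in> qobj C" for C :: "('o, 'o, 'v) qcat" and x y
  proof -
    have "fmor (total_proj C) x y ` el (qhom C x y) = el (qhom C x y)"
      using that by (auto simp: image_iff)
    then show ?thesis by simp
  qed
  have id: "(\<lambda>x\<in>qobj C. x) \<in> q_functors Q C (fibre_qcat (total_cat C, total_proj C))"
      "(\<lambda>x\<in>qobj C. x) \<in> q_functors Q (fibre_qcat (total_cat C, total_proj C)) C"
    for C :: "('o, 'o, 'v) qcat"
    by (simp_all add: q_functors_free_iff eq)
  show ?thesis
  proof (rule two_natural_isomorphism.intro[OF two_natural_transformation.intro two_natural_isomorphism_axioms.intro];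
      unfold id_ftor2_simps comp_ftor2_simps id_ftor_simps comp_ftor_simps total2_simps fibre2_simps QCAT_simps)
    fix C :: "('o, 'o, 'v) qcat"
    show "iso1 K C (fibre_qcat (total_cat C, total_proj C)) (\<lambda>x\<in>qobj C. x)"
      \<comment> \<open>The inverse is the same function, read in the other direction.\<close>
      using id[of C] by (auto simp: iso1_def compose_def intro!: bexI[of _ "\<lambda>x\<in>qobj C. x"])
  next
    fix C D :: "('o, 'o, 'v) qcat" and F assume F: "F \<in> q_functors Q C D"
    then show "compose (qobj C) (\<lambda>x\<in>qobj D. x) F = compose (qobj C) (fobj (total_ftor C F)) (\<lambda>x\<in>qobj C. x)"
      by (auto simp: compose_def q_functors_freeD)
  qed (simp_all add: id)
qed

section \<open>The counit, which compares hom-sets with their images\<close>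

definition counit :: "('o, 'v) cat \<times> ('o, 'v, 'o, 'v) ftor \<Rightarrow> ('o, 'v, 'o, 'v) ftor" where
  "counit = (\<lambda>(E, p). restrict_ftor (total_cat (fibre_qcat (E, p)))
    \<lparr>fobj = (\<lambda>x. x), fmor = (\<lambda>x y. inv_into (Hom E x y) (fmor p x y))\<rparr>)"

text \<open>This is \<open>p\<close> itself with the objects of \<open>E\<close> kept apart:
  followed by the projection of the total category it gives back \<open>p\<close>.\<close>

definition counit_inv :: "('o, 'v) cat \<times> ('o, 'v, 'o, 'v) ftor \<Rightarrow> ('o, 'v, 'o, 'v) ftor" where
  "counit_inv = (\<lambda>(E, p). restrict_ftor E \<lparr>fobj = (\<lambda>x. x), fmor = fmor p\<rparr>)"

lemma fobj_counit [simp]: "x \<in> Obj (fst a) \<Longrightarrow> fobj (counit a) x = x"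
  by (cases a) (simp add: counit_def)

lemma fobj_counit_inv [simp]: "x \<in> Obj (fst a) \<Longrightarrow> fobj (counit_inv a) x = x"
  by (cases a) (simp add: counit_inv_def)

abbreviation T where "T \<equiv> comp_ftor2 total2 fibre2"

lemma T_obj: "a \<in> Obj2 S \<Longrightarrow> obj2 T a \<in> Obj2 S"
  by (cases a) (simp only: comp_ftor2_simps total2_simps fibre2_simps total_obj fibre_obj)

lemma Obj_fst_T [simp]: "Obj (fst (obj2 T a)) = Obj (fst a)"
  by (cases a) simp

text \<open>Faithfulness makes the lift chosen by \<open>inv_into\<close> the only one. So the
  choice is functorial, as identities and composites of lifts are lifts.\<close>

lemma counit_1cell:
  assumes "a \<in> Obj2 S"
  shows "counit a \<in> Obj (Hom2 S (obj2 T a) a)"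
proof -
  obtain E p where a: "a = (E, p)" by (cases a)
  note ob = assms[unfolded a]
  interpret E: category E using ob by (rule slice_objD)
  interpret p: is_functor E B p using ob by (rule slice_objD)
  note inj = slice_objD(5)[OF ob] and C = fibre_obj[OF ob]
  let ?C = "fibre_qcat (E, p)"
  let ?h = "\<lparr>fobj = (\<lambda>x. x), fmor = (\<lambda>x y. inv_into (Hom E x y) (fmor p x y))\<rparr>"
  have "is_functor (total_cat ?C) E ?h"
  proof (rule is_functor.intro; simp add: fibre_hom[OF ob] inv_into_into)
    show "inv_into (Hom E x x) (fmor p x x) (Id B (fobj p x)) = Id E x" if "x \<in> Obj E" for x
      using inv_into_f_f[OF inj[OF that that] E.id_in_hom[OF that]] that by (simp add: p.pres_id)
    show "inv_into (Hom E x z) (fmor p x z) (Comp B (fobj p x) (fobj p y) (fobj p z) g f)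
        = Comp E x y z (inv_into (Hom E y z) (fmor p y z) g) (inv_into (Hom E x y) (fmor p x y) f)"
      if x: "x \<in> Obj E" "y \<in> Obj E" "z \<in> Obj E"
        and f: "f \<in> fmor p x y ` Hom E x y" and g: "g \<in> fmor p y z ` Hom E y z" for x y z f g
    proof -
      let ?f = "inv_into (Hom E x y) (fmor p x y) f" and ?g = "inv_into (Hom E y z) (fmor p y z) g"
      \<comment> \<open>The chosen lifts compose to a lift of the composite, which by injectivity is
        the chosen lift.\<close>
      have "Comp B (fobj p x) (fobj p y) (fobj p z) g f = fmor p x z (Comp E x y z ?g ?f)"
        using x inv_into_into[OF f] inv_into_into[OF g] by (simp add: p.pres_comp f_inv_into_f[OF f] f_inv_into_f[OF g])
      then show ?thesis
        using x by (simp add: inv_into_f_f[OF inj] E.comp_in_hom inv_into_into[OF f] inv_into_into[OF g])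
    qed
  qed
  then have h: "counit (E, p) \<in> functors (total_cat ?C) E"
    unfolding counit_def prod.case by (rule restrict_ftor_in_functors[OF category_total_cat[OF C]])
  have "counit (E, p) \<in> Obj (Hom2 S (total_cat ?C, total_proj ?C) (E, p))"
    by (rule slice_1cellI[OF total_obj[OF C] h])
      (simp_all add: counit_def fibre_hom[OF ob] f_inv_into_f)
  then show ?thesis by (simp only: a comp_ftor2_simps total2_simps fibre2_simps)
qed

lemma counit_inv_1cell:
  assumes "a \<in> Obj2 S"
  shows "counit_inv a \<in> Obj (Hom2 S a (obj2 T a))"
proof -
  obtain E p where a: "a = (E, p)" by (cases a)
  note ob = assms[unfolded a]
  interpret E: category E using ob by (rule slice_objD)
  interpret p: is_functor E B p using ob by (rule slice_objD)
  let ?C = "fibre_qcat (E, p)"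
  have "is_functor E (total_cat ?C) \<lparr>fobj = (\<lambda>x. x), fmor = fmor p\<rparr>"
    by (rule is_functor.intro) (simp_all add: fibre_hom[OF ob] p.pres_id p.pres_comp)
  then have h: "counit_inv (E, p) \<in> functors E (total_cat ?C)"
    unfolding counit_inv_def prod.case by (rule restrict_ftor_in_functors[OF E.category_axioms])
  have "counit_inv (E, p) \<in> Obj (Hom2 S (E, p) (total_cat ?C, total_proj ?C))"
    by (rule slice_1cellI[OF ob h]) (simp_all add: counit_inv_def fibre_hom[OF ob])
  then show ?thesis by (simp only: a comp_ftor2_simps total2_simps fibre2_simps)
qed

text \<open>Equality of 1-cells of \<open>S\<close> is decided on objects. These rules compute
  object parts without splitting an object of \<open>S\<close> into category and functor.\<close>

lemma fobj_S_comp [simp]: "x \<in> Obj (fst a) \<Longrightarrow> fobj (comp1 S a b c g f) x = fobj g (fobj f x)"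
  by (cases a; cases b; cases c) simp

lemma fobj_S_id [simp]: "x \<in> Obj (fst a) \<Longrightarrow> fobj (Id2 S a) x = x"
  by (cases a) simp

lemma fobj_S_closed:
  assumes "h \<in> Obj (Hom2 S a b)" "x \<in> Obj (fst a)"
  shows "fobj h x \<in> Obj (fst b)"
proof -
  obtain E p E' p' where ab: "a = (E, p)" "b = (E', p')" by (cases a, cases b)
  show ?thesis using is_functor.obj[OF slice_1cellD(2)[OF assms(1)[unfolded ab]]] assms(2) by (simp add: ab)
qed

lemma total_fibre_iso: "two_natural_isomorphism S S T id_ftor2 counit"
proof -
  \<comment> \<open>Local functoriality of the round trip suffices here: it types the images of
    1-cells and 2-cells.\<close>
  have hom: "is_functor (Hom2 S a b) (Hom2 S (obj2 T a) (obj2 T b)) (hom2 T a b)"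
    if "a \<in> Obj2 S" "b \<in> Obj2 S" for a b
    unfolding comp_ftor2_simps
    by (rule is_functor_comp_ftor[OF two_functor.hom_functor[OF two_functor_fibre2 that]
          two_functor.hom_functor[OF two_functor_total2 two_functor.obj[OF two_functor_fibre2 that(1)]
            two_functor.obj[OF two_functor_fibre2 that(2)]]])
  have fobj_T: "fobj (fobj (hom2 T a b) h) x = fobj h x" if "x \<in> Obj (fst a)" for a b h x
    using that by (cases a) simp
  \<comment> \<open>Both composites act on objects as \<open>h\<close> does. The equation is
    isolated because naturality for 2-cells needs it again, to match endpoints.\<close>
  have nat1: "comp1 S (obj2 T a) (obj2 T b) b (counit b) (fobj (hom2 T a b) h)
      = comp1 S (obj2 T a) a b h (counit a)"
    if a: "a \<in> Obj2 S" and b: "b \<in> Obj2 S" and h: "h \<in> Obj (Hom2 S a b)" for a b h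
  proof (rule slice_1cell_eqI[OF T_obj[OF a] b])
    note Th = is_functor.obj[OF hom[OF a b] h]
    show "comp1 S (obj2 T a) (obj2 T b) b (counit b) (fobj (hom2 T a b) h) \<in> Obj (Hom2 S (obj2 T a) b)"
      by (rule S.comp1_closed[OF T_obj[OF a] T_obj[OF b] b Th counit_1cell[OF b]])
    show "comp1 S (obj2 T a) a b h (counit a) \<in> Obj (Hom2 S (obj2 T a) b)"
      by (rule S.comp1_closed[OF T_obj[OF a] a b counit_1cell[OF a] h])
    fix x assume "x \<in> Obj (fst (obj2 T a))"
    then have x: "x \<in> Obj (fst a)" by (simp only: Obj_fst_T)
    show "fobj (comp1 S (obj2 T a) (obj2 T b) b (counit b) (fobj (hom2 T a b) h)) x
        = fobj (comp1 S (obj2 T a) a b h (counit a)) x"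
      using x fobj_S_closed[OF h x]
      by (simp only: fobj_S_comp Obj_fst_T fobj_T fobj_counit)
  qed
  show ?thesis
  proof (rule two_natural_isomorphism.intro[OF two_natural_transformation.intro two_natural_isomorphism_axioms.intro];
      unfold id_ftor2_simps id_ftor_simps)
    fix a assume a: "a \<in> Obj2 S"
    show "counit a \<in> Obj (Hom2 S (obj2 T a) a)" by (rule counit_1cell[OF a])
    show "iso1 S (obj2 T a) a (counit a)"
      unfolding iso1_def
    proof (intro conjI bexI)
      note c = counit_1cell[OF a] and ci = counit_inv_1cell[OF a] and Ta = T_obj[OF a]
      show "counit a \<in> Obj (Hom2 S (obj2 T a) a)" by (rule c)
      show "counit_inv a \<in> Obj (Hom2 S a (obj2 T a))" by (rule ci)
      \<comment> \<open>No computation with \<open>inv_into\<close> on morphisms is made: both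
        composites fix all objects, and faithfulness settles the rest.\<close>
      show "comp1 S (obj2 T a) a (obj2 T a) (counit_inv a) (counit a) = Id2 S (obj2 T a)"
        by (rule slice_1cell_eqI[OF Ta Ta S.comp1_closed[OF Ta a Ta c ci] S.id1[OF Ta]])
          (simp only: fobj_S_comp fobj_S_id Obj_fst_T fobj_counit fobj_counit_inv)
      show "comp1 S a (obj2 T a) a (counit a) (counit_inv a) = Id2 S a"
        by (rule slice_1cell_eqI[OF a a S.comp1_closed[OF a Ta a ci c] S.id1[OF a]])
          (simp only: fobj_S_comp fobj_S_id Obj_fst_T fobj_counit fobj_counit_inv)
    qed
    fix b h assume b: "b \<in> Obj2 S" and h: "h \<in> Obj (Hom2 S a b)"
    show "comp1 S (obj2 T a) (obj2 T b) b (counit b) (fobj (hom2 T a b) h)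
        = comp1 S (obj2 T a) a b h (counit a)"
      by (rule nat1[OF a b h])
    fix k \<alpha> assume k: "k \<in> Obj (Hom2 S a b)" and \<alpha>: "\<alpha> \<in> Hom (Hom2 S a b) h k"
    note T = is_functor.obj[OF hom[OF a b]] is_functor.mor[OF hom[OF a b]]
    \<comment> \<open>\<open>l\<close> and \<open>r\<close> type the two sides of the naturality
      equation for \<alpha>. By \<open>nat1\<close> their sources and targets coincide, and parallel
      2-cells are equal.\<close>
    note l = S.hcomp_closed[OF T_obj[OF a] T_obj[OF b] b T(1)[OF h] T(1)[OF k] T(2)[OF h k \<alpha>]
        counit_1cell[OF b] counit_1cell[OF b] S.id2_closed[OF T_obj[OF b] b counit_1cell[OF b]]]
    note r = S.hcomp_closed[OF T_obj[OF a] a b counit_1cell[OF a] counit_1cell[OF a]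
        S.id2_closed[OF T_obj[OF a] a counit_1cell[OF a]] h k \<alpha>]
    note c = S.comp1_closed[OF T_obj[OF a] a b counit_1cell[OF a]]
    show "hcomp S (obj2 T a) (obj2 T b) b (counit b) (counit b) (fobj (hom2 T a b) h) (fobj (hom2 T a b) k)
        (Id (Hom2 S (obj2 T b) b) (counit b)) (fmor (hom2 T a b) h k \<alpha>)
      = hcomp S (obj2 T a) a b h k (counit a) (counit a) \<alpha> (Id (Hom2 S (obj2 T a) a) (counit a))"
      by (rule slice_2cell_unique[OF T_obj[OF a] b c[OF h] c[OF k] l[unfolded nat1[OF a b h] nat1[OF a b k]] r])
  qed
qed

end

theorem proposition3p5:
  fixes el :: "'v \<Rightarrow> 'v set" and B :: "('o, 'v) cat"
  assumes "grothendieck_universe el"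
    and "ordinary_category el B"
  shows "two_equivalent
    (QCAT (free_quantaloid el B) :: (('o, 'o, 'v) qcat, 'o \<Rightarrow> 'o, unit) cat2)
    (full_sub2 (slice2 (CAT el) B) (\<lambda>(E, p). faithful E p))"
proof -
  interpret free_quantaloid_base el B
    using assms by (rule free_quantaloid_base.intro)
  show ?thesis
    unfolding two_equivalent_def
    using two_category_K two_category_S two_functor_total2 two_functor_fibre2 fibre_total_iso total_fibre_iso
    by blast
qed

end
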